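(* Let $G_n$ be the size of the greedy independent set on a uniform Cayley tree $\mathcal{T}_n$ of size $n$. For all $A\ge 0$, $$\mathbb{P}\left(G_n=\left\lfloor\frac{n}{2}+x\sqrt{n}\right\rfloor\right)\underset{n\to\infty}{\sim}\frac{1}{\sqrt{n}}\,\frac{1}{\sqrt{2\pi(1/4)^2}}\exp\left(-\frac{x^2}{2\cdot(1/4)^2}\right)$$ uniformly for $x\in[-A,A]$.
   Context: A Cayley tree of size $n$ is an unrooted, unordered tree on the labeled vertex set $\{1,\dots,n\}$; $\mathcal{T}_n$ is uniformly random among the $n^{n-2}$ Cayley trees of size $n$. Greedy independent set of a finite graph with vertex set $V$: vertices have one of three statuses, undetermined ($\mathcal{U}_k$), active ($\mathcal{A}_k$), blocked ($\mathcal{B}_k$). Initially $\mathcal{U}_0=V$, $\mathcal{A}_0=\mathcal{B}_0=\emptyset$. At each step $k\ge 1$, an undetermined vertex $v_k$ is chosen uniformly at random among the currently undetermined vertices (given the graph and the past choices), its status is changed to active, and the status of all its undetermined neighbours is changed to blocked. The procedure stops at $\tau=\min\{k\ge 0:\mathcal{U}_k=\emptyset\}$, and $\mathcal{A}_\tau$ is the greedy independent set. $G_n$ is $|\mathcal{A}_\tau|$ when the graph is $\mathcal{T}_n$. "$\sim$ uniformly for $x\in[-A,A]$" means that the ratio of the two sides tends to $1$ as $n\to\infty$, uniformly in $x\in[-A,A]$. *)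

theory Defs
  imports "HOL-Probability.Probability" "Graph_Theory.Graph_Theory"
begin

text \<open>
  A finite simple graph is a symmetric, loop-free, finite digraph, i.e. a \<open>pair_graph\<close>.  In this
  encoding every edge gives the two-arc closed walk \<open>u, v, u\<close>, which \<open>pre_digraph.cycle\<close> counts as a
  cycle; hence the library's \<open>tree\<close> is not the notion for undirected graphs.  The cycles of the
  undirected graph are exactly those of length at least 3.
\<close>

definition undirected_tree :: "'a pair_pre_digraph \<Rightarrow> bool" where
  "undirected_tree T \<longleftrightarrow>
     pair_graph T \<and> Digraph_Component.connected (with_proj T) \<and>
     \<not> (\<exists>p. pre_digraph.cycle (with_proj T) p \<and> length p \<ge> 3)"

definition cayley_trees :: "nat \<Rightarrow> nat pair_pre_digraph set" where
  "cayley_trees n = {T. pverts T = {1..n} \<and> undirected_tree T}"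

lemma finite_cayley_trees: "finite (cayley_trees n)"
proof (rule finite_subset)
  show "cayley_trees n \<subseteq> (\<lambda>E. \<lparr>pverts = {1..n}, parcs = E\<rparr>) ` Pow ({1..n} \<times> {1..n})"
  proof
    fix T assume T: "T \<in> cayley_trees n"
    then interpret pair_graph T
      by (simp add: cayley_trees_def undirected_tree_def)
    have "parcs T \<subseteq> {1..n} \<times> {1..n}"
      using T in_arcsD1 in_arcsD2 by (force simp: cayley_trees_def)
    moreover have "T = \<lparr>pverts = {1..n}, parcs = parcs T\<rparr>"
      using T by (simp add: cayley_trees_def)
    ultimately show "T \<in> (\<lambda>E. \<lparr>pverts = {1..n}, parcs = E\<rparr>) ` Pow ({1..n} \<times> {1..n})"
      by blast
  qed
qed simp

lemma cayley_trees_nonempty: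
  assumes "n \<ge> 1"
  shows "cayley_trees n \<noteq> {}"
proof -
  define T :: "nat pair_pre_digraph" where
    "T = \<lparr>pverts = {1..n}, parcs = {1} \<times> {2..n} \<union> {2..n} \<times> {1}\<rparr>"
  have star: "(u = 1) \<noteq> (v = 1)" if "(u, v) \<in> parcs T" for u v
    using that by (auto simp: T_def)
  interpret pair_graph T
  proof unfold_locales
    show "symmetric (with_proj T)"
      by (auto simp: symmetric_def T_def sym_def)
  qed (use assms in \<open>auto simp: T_def\<close>)
  have "Digraph_Component.strongly_connected (with_proj T)"
    unfolding strongly_connected_def
  proof (intro conjI ballI)
    show "verts (with_proj T) \<noteq> {}"
      using assms by (simp add: T_def)
    have to_centre: "u \<rightarrow>\<^sup>*\<^bsub>with_proj T\<^esub> 1" and from_centre: "1 \<rightarrow>\<^sup>*\<^bsub>with_proj T\<^esub> u"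
      if "u \<in> {1..n}" for u
    proof -
      have "u = 1 \<or> (u, 1) \<in> parcs T \<and> (1, u) \<in> parcs T"
        using that by (auto simp: T_def)
      moreover have "1 \<in> pverts T"
        using assms by (simp add: T_def)
      ultimately show "u \<rightarrow>\<^sup>*\<^bsub>with_proj T\<^esub> 1" "1 \<rightarrow>\<^sup>*\<^bsub>with_proj T\<^esub> u"
        by auto
    qed
    fix u v assume "u \<in> verts (with_proj T)" "v \<in> verts (with_proj T)"
    hence "u \<in> {1..n}" "v \<in> {1..n}" by (auto simp: T_def)
    thus "u \<rightarrow>\<^sup>*\<^bsub>with_proj T\<^esub> v"
      using to_centre from_centre reachable_trans by blast
  qed
  hence "Digraph_Component.connected (with_proj T)"
    by (simp add: Digraph_Component.connected_def strongly_connected_def reachable_mk_symmetricI)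
  moreover have "\<not> (\<exists>p. pre_digraph.cycle (with_proj T) p \<and> length p \<ge> 3)"
  proof safe
    fix p assume c: "pre_digraph.cycle (with_proj T) p" and len: "length p \<ge> 3"
    obtain a b e es where p: "p = a # b # e # es"
      using len by (metis Suc_le_length_iff numeral_3_eq_3)
    from c obtain u where u: "set p \<subseteq> parcs T" "pcas u p u" "distinct (tl (pawalk_verts u p))"
      unfolding pre_digraph.cycle_def pre_digraph.awalk_def
      by (auto simp: cas_with_proj_eq awalk_verts_with_proj_eq)
    have ne: "pawalk_verts x q \<noteq> []" for x q
      by (cases q) auto
    have last: "last (pawalk_verts x q) = y" if "pcas x q y" for x y q
      using that by (induction q arbitrary: x) (auto simp: ne)
    have arcs: "(fst a, fst b) \<in> parcs T" "(fst b, fst e) \<in> parcs T" "(fst e, snd e) \<in> parcs T"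
      and "u = fst a" and rest: "pcas (snd e) es u" and snds: "snd a = fst b" "snd b = fst e"
      using u p by (cases a; cases b; cases e; auto)+
    have "u \<in> set (pawalk_verts (snd e) es)"
      using last[OF rest] ne last_in_set by metis
    moreover have "snd e \<in> set (pawalk_verts (snd e) es)"
      using rest by (cases es) auto
    ultimately have "u \<noteq> fst e" "fst b \<noteq> snd e"
      using u(3) p snds by auto
    thus False
      using star[OF arcs(1)] star[OF arcs(2)] star[OF arcs(3)] \<open>u = fst a\<close> by auto
  qed
  ultimately have "T \<in> cayley_trees n"
    using pair_graph_axioms by (simp add: cayley_trees_def undirected_tree_def T_def)
  thus ?thesis by blast
qed

definition neighbours :: "'a pair_pre_digraph \<Rightarrow> 'a \<Rightarrow> 'a set" where
  "neighbours G v = {w. (v, w) \<in> parcs G}"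

text \<open>A state is the triple (undetermined, active, blocked) of sets of vertices.\<close>

type_synonym 'a greedy_state = "'a set \<times> 'a set \<times> 'a set"

fun greedy_step :: "'a pair_pre_digraph \<Rightarrow> 'a \<Rightarrow> 'a greedy_state \<Rightarrow> 'a greedy_state" where
  "greedy_step G v (U, A, B) =
     (U - insert v (neighbours G v), insert v A, B \<union> (U \<inter> neighbours G v))"

text \<open>
  The distribution of the active set at the first time at which no vertex is undetermined, starting
  from a given state.  The clause for infinite \<open>U\<close> only makes the function total.
\<close>

function greedy_run :: "'a pair_pre_digraph \<Rightarrow> 'a greedy_state \<Rightarrow> 'a set pmf" where
  "greedy_run G (U, A, B) =
     (if U = {} \<or> infinite U then return_pmf A
      else bind_pmf (pmf_of_set U) (\<lambda>v. greedy_run G (greedy_step G v (U, A, B))))"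
  by pat_completeness auto
termination
proof (relation "Wellfounded.measure (\<lambda>(G, U, A, B). card U)", goal_cases)
  case 1
  show ?case by simp
next
  case (2 G U A B v)
  hence "finite U" "v \<in> U" by auto
  hence "card (U - insert v (neighbours G v)) < card U"
    by (intro psubset_card_mono) auto
  thus ?case by simp
qed

declare greedy_run.simps [simp del]

definition greedy_independent_set :: "'a pair_pre_digraph \<Rightarrow> 'a set pmf" where
  "greedy_independent_set G = greedy_run G (pverts G, {}, {})"

text \<open>
  The law of the size of the greedy independent set on a uniform Cayley tree of size \<open>n\<close>.  It is
  meaningful only for \<open>n \<ge> 1\<close>, since there is no Cayley tree of size 0.
\<close>

definition greedy_size_cayley :: "nat \<Rightarrow> nat pmf" where
  "greedy_size_cayley n =
     bind_pmf (pmf_of_set (cayley_trees n)) (\<lambda>T. map_pmf card (greedy_independent_set T))"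

end

theory Submission
  imports Defs "HOL-Real_Asymp.Real_Asymp"
begin

text \<open>
  The law of the greedy independent set on a uniform Cayley tree is explicit: for \<open>n \<ge> 2\<close> and \<open>k \<ge> 1\<close>,
  \<open>P(G_n = k) = (n-1 choose k-1) (n-k)^(k-1) k^(n-k-1) / n^(n-2)\<close>
  (\<open>pmf_greedy_size_cayley\<close>), and the local limit theorem is read off from this formula with
  Stirling's approximation (\<open>greedy_size_prob_local_limit\<close>).

  The exact law rests on a Markov property.  Let the algorithm activate a vertex \<open>v\<close> and block its
  neighbours \<open>D\<close>.  What is left of the tree is a forest in which every component is attached to some
  element of \<open>D\<close> through one of its own vertices.  Calling that vertex the root of the component, the
  leftover is a rooted forest on the undetermined vertices \<open>U\<close> together with an attachment of each
  root to a blocked vertex, that is, an acyclic parent map from \<open>U\<close> to \<open>U \<union> Y\<close> with \<open>Y = D\<close>, and all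
  such maps are equally likely.  This class is stable.  In a uniform parent map, one reroots the
  component of the next active vertex \<open>v\<close> at \<open>v\<close> and then deletes \<open>v\<close>; the leftover is a parent map
  into \<open>U' \<union> (Y \<union> D)\<close>, and each one occurs with a multiplicity depending only on how many vertices
  hang below \<open>D\<close>.  Since the elements of \<open>Y \<union> D\<close> are exchangeable and the algorithm no longer sees
  them, this multiplicity can be replaced by its mean (\<open>sum_removed_vertex\<close>).

  Therefore the sum over all parent maps of the probability that exactly \<open>k\<close> vertices become active
  depends only on \<open>N = |U|\<close> and \<open>y = |Y|\<close> and satisfies a recursion in \<open>k\<close>.  Its solution is
  \<open>(N choose k) y k^(N-k) (N-k+y)^(k-1)\<close> (\<open>sum_greedy_prob\<close>): with this ansatz the factor
  \<open>N-k+y\<close> is the same in all terms of the recursion, which then reduces to the binomial theorem.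
  The number of Cayley trees comes out of the same recursion, applied to the constant function
  (\<open>card_parent_maps\<close>).
\<close>

section \<open>Rooted forests as parent maps\<close>

text \<open>
  The elements of \<open>Y\<close> are the roots.  Points outside \<open>U\<close> are fixed, so that iterating a parent map from any vertex ends at its root and
  stays there, and so that the undirected edges can be read off without mentioning \<open>U\<close>.  Acyclicity
  is expressed by a rank function, which restricts to subsets and is easy to adapt when a forest
  is modified.
\<close>

definition parent_maps :: "'a set \<Rightarrow> 'a set \<Rightarrow> ('a \<Rightarrow> 'a) set" where
  "parent_maps U Y = {f. (\<forall>u\<in>U. f u \<in> U \<union> Y) \<and> (\<forall>u. u \<notin> U \<longrightarrow> f u = u) \<and>
                          (\<exists>h::'a \<Rightarrow> nat. \<forall>u\<in>U. h (f u) < h u)}"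

definition edges :: "('a \<Rightarrow> 'a) \<Rightarrow> ('a \<times> 'a) set" where
  "edges f = {(a, b). a \<noteq> b \<and> (f a = b \<or> f b = a)}"

definition leads :: "('a \<Rightarrow> 'a) \<Rightarrow> 'a \<Rightarrow> 'a \<Rightarrow> bool" where
  "leads f u z \<longleftrightarrow> (\<exists>k. (f ^^ k) u = z)"

lemma parent_mapsE:
  assumes "f \<in> parent_maps U Y"
  obtains h :: "'a \<Rightarrow> nat" where "\<And>u. u \<in> U \<Longrightarrow> f u \<in> U \<union> Y" "\<And>u. u \<notin> U \<Longrightarrow> f u = u"
    "\<And>u. u \<in> U \<Longrightarrow> h (f u) < h u"
  using assms unfolding parent_maps_def by blast

lemma parent_mapsI:
  fixes h :: "'a \<Rightarrow> nat"
  assumes "\<And>u. u \<in> U \<Longrightarrow> f u \<in> U \<union> Y" "\<And>u. u \<notin> U \<Longrightarrow> f u = u" "\<And>u. u \<in> U \<Longrightarrow> h (f u) < h u"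
  shows "f \<in> parent_maps U Y"
  using assms unfolding parent_maps_def by blast

lemma parent_maps_in: "f \<in> parent_maps U Y \<Longrightarrow> u \<in> U \<Longrightarrow> f u \<in> U \<union> Y"
  and parent_maps_fix: "f \<in> parent_maps U Y \<Longrightarrow> u \<notin> U \<Longrightarrow> f u = u"
  unfolding parent_maps_def by auto

lemma parent_maps_neq: "f \<in> parent_maps U Y \<Longrightarrow> u \<in> U \<Longrightarrow> f u \<noteq> u"
  by (metis parent_mapsE less_irrefl)

lemma edges_iff: "(a, b) \<in> edges f \<longleftrightarrow> a \<noteq> b \<and> (f a = b \<or> f b = a)"
  by (simp add: edges_def)

lemma sym_edges: "sym (edges f)"
  by (auto simp: edges_def sym_def)

lemma finite_parent_maps:
  assumes "finite U" "finite Y"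
  shows "finite (parent_maps U Y)"
proof (rule finite_subset)
  show "parent_maps U Y \<subseteq> (\<lambda>f u. if u \<in> U then f u else u) ` (U \<rightarrow>\<^sub>E U \<union> Y)"
  proof
    fix f assume f: "f \<in> parent_maps U Y"
    have "f = (\<lambda>u. if u \<in> U then restrict f U u else u)"
      using parent_maps_fix[OF f] by auto
    moreover have "restrict f U \<in> U \<rightarrow>\<^sub>E U \<union> Y"
      using parent_maps_in[OF f] by (simp add: restrict_PiE_iff)
    ultimately show "f \<in> (\<lambda>f u. if u \<in> U then f u else u) ` (U \<rightarrow>\<^sub>E U \<union> Y)" by blast
  qed
  show "finite ((\<lambda>f u. if u \<in> U then f u else u) ` (U \<rightarrow>\<^sub>E U \<union> Y))"
    using assms by (intro finite_imageI finite_PiE) auto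
qed

lemma parent_maps_empty: "parent_maps {} Y = {id}"
  unfolding parent_maps_def by auto

lemma parent_maps_no_roots:
  fixes U :: "'a set"
  assumes "finite U" "U \<noteq> {}" shows "parent_maps U {} = {}"
proof -
  have False if f: "f \<in> parent_maps U {}" for f
  proof -
    obtain h :: "'a \<Rightarrow> nat" where h: "\<And>u. u \<in> U \<Longrightarrow> f u \<in> U" "\<And>u. u \<in> U \<Longrightarrow> h (f u) < h u"
      using f unfolding parent_maps_def by auto
    obtain u where "u \<in> U" "\<And>w. w \<in> U \<Longrightarrow> h u \<le> h w"
      using ex_min_if_finite[of "h ` U"] assms by (metis finite_imageI arg_min_if_finite arg_min_least)
    thus False using h by (meson not_le)
  qed
  thus ?thesis by blast
qed

lemma leads_refl [simp]: "leads f u u"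
  unfolding leads_def by (rule exI[of _ 0]) simp

lemma leads_step: "leads f (f u) z \<Longrightarrow> leads f u z"
  unfolding leads_def by (metis funpow_Suc_right o_apply)

lemma funpow_fix: "f z = z \<Longrightarrow> (f ^^ k) z = z"
  by (induction k) auto

lemma leads_fixed: "f z = z \<Longrightarrow> leads f z w \<longleftrightarrow> w = z"
  unfolding leads_def by (auto simp: funpow_fix intro: exI[of _ 0])

lemma leads_step_iff: "f z = z \<Longrightarrow> leads f (f u) z \<longleftrightarrow> leads f u z"
proof
  assume "f z = z" "leads f u z"
  then obtain k where "(f ^^ k) u = z" by (auto simp: leads_def)
  hence "(f ^^ k) (f u) = z"
    using \<open>f z = z\<close> by (metis funpow_swap1)
  thus "leads f (f u) z" by (auto simp: leads_def)
qed (rule leads_step)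

lemma leads_unique:
  assumes "leads f u z" "leads f u z'" "f z = z" "f z' = z'"
  shows "z = z'"
proof -
  obtain j k where jk: "(f ^^ j) u = z" "(f ^^ k) u = z'"
    using assms by (auto simp: leads_def)
  have "(f ^^ (j + k)) u = z'" using jk(2) assms(4) by (simp add: funpow_add funpow_fix)
  moreover have "(f ^^ (k + j)) u = z" using jk(1) assms(3) by (simp add: funpow_add funpow_fix)
  ultimately show ?thesis by (simp add: add.commute)
qed

lemma leads_rtrancl: "leads f u z \<Longrightarrow> (u, z) \<in> (edges f)\<^sup>*"
proof -
  have "(u, (f ^^ k) u) \<in> (edges f)\<^sup>*" for k
  proof (induction k)
    case (Suc k)
    have "(f ^^ Suc k) u = (f ^^ k) u \<or> ((f ^^ k) u, (f ^^ Suc k) u) \<in> edges f"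
      by (auto simp: edges_iff)
    with Suc show ?case by (metis rtrancl.rtrancl_into_rtrancl)
  qed simp
  thus "leads f u z \<Longrightarrow> (u, z) \<in> (edges f)\<^sup>*" by (auto simp: leads_def)
qed

lemma rtrancl_leads:
  assumes "(u, z) \<in> (edges f)\<^sup>*" "f z = z"
  shows "leads f u z"
  using assms
proof (induction rule: converse_rtrancl_induct)
  case (step a b)
  hence "leads f b z" and "f a = b \<or> f b = a" by (auto simp: edges_iff)
  thus ?case using leads_step leads_step_iff[where f = f and z = z] \<open>f z = z\<close> by metis
qed simp

lemma parent_maps_leads:
  fixes U :: "'a set"
  assumes f: "f \<in> parent_maps U Y" and u: "u \<in> U \<union> Y"
  shows "\<exists>z\<in>Y. leads f u z"
proof -
  obtain h :: "'a \<Rightarrow> nat" where h: "\<And>u. u \<in> U \<Longrightarrow> f u \<in> U \<union> Y" "\<And>u. u \<in> U \<Longrightarrow> h (f u) < h u"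
    using f unfolding parent_maps_def by auto
  show ?thesis using u
  proof (induction "h u" arbitrary: u rule: less_induct)
    case less
    thus ?case using h leads_step leads_refl by (metis UnE)
  qed
qed

text \<open>
  Once the roots are prescribed, an undirected forest has only one orientation towards them: a vertex
  of minimal rank with two different parents would be the parent of its parent.  Sums over parent
  maps can thus be turned into sums over undirected graphs.
\<close>

lemma edges_determine_parent_map:
  fixes U :: "'a set"
  assumes f: "f \<in> parent_maps U Y" and g: "g \<in> parent_maps U Y" and eq: "edges f = edges g"
  shows "f = g"
proof
  fix u
  obtain h :: "'a \<Rightarrow> nat" where h: "\<And>u. u \<in> U \<Longrightarrow> h (f u) < h u"
    using f unfolding parent_maps_def by auto
  show "f u = g u"
  proof (cases "u \<in> U")
    case True
    thus ?thesis
    proof (induction "h u" arbitrary: u rule: less_induct)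
      case less
      show ?case
      proof (rule ccontr)
        assume neq: "f u \<noteq> g u"
        have "(u, f u) \<in> edges g"
          using parent_maps_neq[OF f less.prems] by (simp flip: eq add: edges_iff)
        hence gu: "g (f u) = u" "f u \<noteq> u" using neq by (auto simp: edges_iff)
        hence "f u \<in> U" using parent_maps_fix[OF g] by metis
        hence "f (f u) = u" using less.hyps[of "f u"] h[OF less.prems] gu by simp
        thus False using h[OF \<open>f u \<in> U\<close>] h[OF less.prems] by simp
      qed
    qed
  qed (use parent_maps_fix[OF f] parent_maps_fix[OF g] in simp)
qed

section \<open>Rerooting\<close>

lemma reroot_child:
  fixes U :: "'a set"
  assumes f: "f \<in> parent_maps U Y" and disj: "U \<inter> Y = {}" and "r \<in> Y" "f c = r" "c \<noteq> r"
  shows "f(c := c, r := c) \<in> parent_maps (insert r U - {c}) (insert c (Y - {r}))"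
    and "edges (f(c := c, r := c)) = edges f"
proof -
  obtain h :: "'a \<Rightarrow> nat" where h: "\<And>u. u \<in> U \<Longrightarrow> f u \<in> U \<union> Y" "\<And>u. u \<notin> U \<Longrightarrow> f u = u"
    "\<And>u. u \<in> U \<Longrightarrow> h (f u) < h u"
    using f unfolding parent_maps_def by auto
  have fr: "f r = r" and rU: "r \<notin> U" using disj \<open>r \<in> Y\<close> h(2) by auto
  show "edges (f(c := c, r := c)) = edges f"
    using fr assms(4,5) unfolding edges_def by (auto split: if_splits)
  show "f(c := c, r := c) \<in> parent_maps (insert r U - {c}) (insert c (Y - {r}))"
  proof (rule parent_mapsI[where h = "\<lambda>u. if u = c then 0 else Suc (h u)"])
  qed (use h assms rU in auto)
qed

text \<open>
  A root can be moved to any vertex of its component without changing the undirected graph, by moving it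
  along the edges of a path one at a time.
\<close>

lemma reroot:
  assumes f: "f \<in> parent_maps U Y" and disj: "U \<inter> Y = {}" and r: "r \<in> Y"
    and conn: "(r, v) \<in> (edges f)\<^sup>*"
  shows "\<exists>g \<in> parent_maps (insert r U - {v}) (insert v (Y - {r})). edges g = edges f"
proof -
  from conn have "v \<in> insert r U \<and>
    (\<exists>g \<in> parent_maps (insert r U - {v}) (insert v (Y - {r})). edges g = edges f)"
  proof (induction rule: rtrancl_induct)
    case base
    have "insert r U - {r} = U" "insert r (Y - {r}) = Y" using disj r by auto
    thus ?case using f by auto
  next
    case (step w v)
    then obtain g where w: "w \<in> insert r U" and
      g: "g \<in> parent_maps (insert r U - {w}) (insert w (Y - {r}))" "edges g = edges f"
      by blast
    have gw: "g w = w" using parent_maps_fix[OF g(1)] by blast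
    have "(w, v) \<in> edges g" using step g by simp
    hence v: "g v = w" "v \<noteq> w" using gw by (auto simp: edges_iff)
    hence vU: "v \<in> insert r U - {w}" using parent_maps_fix[OF g(1)] by metis
    have sets: "insert w (insert r U - {w}) - {v} = insert r U - {v}"
      "insert v (insert w (Y - {r}) - {w}) = insert v (Y - {r})" using w disj r by auto
    have "(insert r U - {w}) \<inter> insert w (Y - {r}) = {}" using disj by auto
    note R = reroot_child[OF g(1) this _ v, unfolded sets]
    show ?case using R vU g(2) by auto
  qed
  thus ?thesis by blast
qed

lemma reroot_leads:
  assumes f: "f \<in> parent_maps U Y" and disj: "U \<inter> Y = {}" and r: "r \<in> Y" and l: "leads f v r" 
  shows "\<exists>g \<in> parent_maps (insert r U - {v}) (insert v (Y - {r})). leads g r v \<and> edges g = edges f"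
proof -
  have "(r, v) \<in> (edges f)\<^sup>*"
    using leads_rtrancl[OF l] sym_rtrancl[OF sym_edges, of f] by (meson symE)
  moreover from reroot[OF f disj r this] obtain g
    where g: "g \<in> parent_maps (insert r U - {v}) (insert v (Y - {r}))" "edges g = edges f" by blast
  moreover have "g v = v" using parent_maps_fix[OF g(1)] by simp
  ultimately show ?thesis using rtrancl_leads[of r v g] by auto
qed

text \<open>
  Both sums run over the same undirected graphs, each of which occurs once on either side.
\<close>

lemma sum_reroot:
  assumes disj: "U \<inter> Y = {}" and r: "r \<in> Y" and v: "v \<in> U"
  shows "(\<Sum>f | f \<in> parent_maps U Y \<and> leads f v r. F (edges f)) =
    (\<Sum>g | g \<in> parent_maps (insert r (U - {v})) (insert v (Y - {r})) \<and> leads g r v. F (edges g))"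
    (is "sum _ ?S = sum _ ?T")
proof -
  have "edges ` ?S = edges ` ?T"
  proof
    have "insert r U - {v} = insert r (U - {v})" using disj r v by auto
    hence "\<exists>g\<in>?T. edges g = edges f" if "f \<in> ?S" for f
      using reroot_leads[OF _ disj r, of f v] that by auto
    thus "edges ` ?S \<subseteq> edges ` ?T" by (metis (no_types, lifting) image_subsetI imageI)
    have sets: "insert v (insert r (U - {v})) - {r} = U" "insert r (insert v (Y - {r}) - {v}) = Y"
      using disj r v by auto
    have disj': "insert r (U - {v}) \<inter> insert v (Y - {r}) = {}" using disj r v by auto
    have "\<exists>f\<in>?S. edges f = edges g" if "g \<in> ?T" for g
      using reroot_leads[OF _ disj', of g v r] that unfolding sets by auto
    thus "edges ` ?T \<subseteq> edges ` ?S" by (metis (no_types, lifting) image_subsetI imageI)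
  qed
  moreover have "inj_on edges ?S" "inj_on edges ?T"
    by (auto intro!: inj_onI dest: edges_determine_parent_map)
  hence "(\<Sum>f\<in>?S. F (edges f)) = sum F (edges ` ?S)" "(\<Sum>f\<in>?T. F (edges f)) = sum F (edges ` ?T)"
    by (simp_all add: sum.reindex)
  ultimately show ?thesis by simp
qed

lemma leads_cut:
  assumes f: "f \<in> parent_maps (insert y U) Y" and v: "v \<notin> insert y U" and l: "leads f y v"
  shows "leads (f(y := y)) (f y) v"
proof -
  obtain h :: "'a \<Rightarrow> nat" where h: "\<And>u. u \<in> insert y U \<Longrightarrow> h (f u) < h u" "\<And>u. u \<notin> insert y U \<Longrightarrow> f u = u"
    using f unfolding parent_maps_def by auto
  have le: "h (f u) \<le> h u" for u using h by (cases "u \<in> insert y U") (auto intro: less_imp_le)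
  have *: "leads (f(y := y)) w v" if "(f ^^ k) w = v" "h w < h y" for k w
    using that
  proof (induction k arbitrary: w)
    case (Suc k)
    have "(f ^^ k) (f w) = v" using Suc.prems(1) by (metis funpow_Suc_right o_apply)
    hence "leads (f(y := y)) (f w) v" using Suc.IH[of "f w"] Suc.prems(2) le[of w] by linarith
    moreover have "(f(y := y)) w = f w" using Suc.prems(2) by auto
    ultimately show ?case using leads_step by metis
  qed auto
  have "f v = v" using v h(2) by simp
  hence "leads f (f y) v" using l leads_step_iff[where f = f and z = v] by metis
  thus ?thesis using * h(1)[of y] unfolding leads_def by blast
qed

lemma leads_attach:
  assumes g: "g y = y" and l: "leads g p v" and ne: "v \<noteq> y"
  shows "leads (g(y := q)) p v"
proof -
  have "leads (g(y := q)) w v" if "(g ^^ k) w = v" for k w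
    using that
  proof (induction k arbitrary: w)
    case (Suc k)
    have "(g ^^ k) (g w) = v" using Suc.prems(1) by (metis funpow_Suc_right o_apply)
    hence "leads (g(y := q)) (g w) v" by (rule Suc.IH)
    moreover have "w \<noteq> y" using Suc.prems g funpow_fix[where f = g and z = y] ne by metis
    ultimately show ?case by (metis leads_step fun_upd_other)
  qed auto
  thus ?thesis using l unfolding leads_def by blast
qed

lemma parent_maps_attach:
  fixes U :: "'a set"
  assumes g: "g \<in> parent_maps U (insert y Y)" and y: "y \<notin> U \<union> Y" and v: "v \<in> Y" "v \<notin> U"
    and p: "p \<in> insert v U" "leads g p v"
  shows "g(y := p) \<in> parent_maps (insert y U) Y"
proof -
  obtain h :: "'a \<Rightarrow> nat" where h: "\<And>u. u \<in> U \<Longrightarrow> g u \<in> insert y (U \<union> Y)"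
    "\<And>u. u \<in> U \<Longrightarrow> h (g u) < h u" "\<And>u. u \<notin> U \<Longrightarrow> g u = u"
    using g unfolding parent_maps_def by auto
  have fixed: "g y = y" "g v = v" using h(3) y v by auto
  have "\<not> leads g p y" using leads_unique[of g p y v] fixed p(2) y v by auto
  \<comment> \<open>Everything hung below \<open>y\<close> is lifted above \<open>p\<close>.\<close>
  show ?thesis
  proof (rule parent_mapsI[where h = "\<lambda>w. h w + (if leads g w y then Suc (h p) else 0)"], goal_cases)
    case (3 u)
    show ?case
    proof (cases "u = y")
      case True
      thus ?thesis using \<open>\<not> leads g p y\<close> by simp
    next
      case False
      hence "u \<in> U" using 3 by simp
      thus ?thesis using False h(2)[of u] leads_step_iff[where f = g and z = y] fixed by simp
    qed
  qed (use h p v y in auto)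
qed

text \<open>
  The root \<open>y\<close> is turned into an ordinary vertex by choosing a parent \<open>p\<close> for it.  This keeps the forest
  acyclic, with \<open>y\<close> in the component of \<open>v\<close>, exactly if \<open>p\<close> lies in that component.
\<close>

lemma sum_attach:
  assumes fin: "finite U" "finite Y" and y: "y \<notin> U \<union> Y" and v: "v \<in> Y" "v \<notin> U"
  shows "(\<Sum>f | f \<in> parent_maps (insert y U) Y \<and> leads f y v. F f) =
    (\<Sum>g\<in>parent_maps U (insert y Y). \<Sum>p | p \<in> insert v U \<and> leads g p v. F (g(y := p)))"
proof -
  have "(\<Sum>g\<in>parent_maps U (insert y Y). \<Sum>p | p \<in> insert v U \<and> leads g p v. F (g(y := p))) =
    (\<Sum>(g, p)\<in>(SIGMA g:parent_maps U (insert y Y). {p \<in> insert v U. leads g p v}). F (g(y := p)))"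
    using fin by (intro sum.Sigma finite_parent_maps ballI) auto
  also have "\<dots> = (\<Sum>f | f \<in> parent_maps (insert y U) Y \<and> leads f y v. F f)"
  proof (rule sum.reindex_bij_witness[where i = "\<lambda>f. (f(y := y), f y)" and j = "\<lambda>(g, p). g(y := p)"], goal_cases)
    case (1 x)
    obtain g p where x: "x = (g, p)" by force
    have g: "g \<in> parent_maps U (insert y Y)" using 1 x by auto
    hence "g y = y" using parent_maps_fix[OF g, of y] y by simp
    thus ?case using x by auto
  next
    case (2 x)
    obtain g p where x: "x = (g, p)" by force
    have g: "g \<in> parent_maps U (insert y Y)" and p: "p \<in> insert v U" "leads g p v" using 2 x by auto
    hence "g y = y" using parent_maps_fix[OF g, of y] y by simp
    hence "leads (g(y := p)) p v" by (rule leads_attach) (use p y v in auto)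
    hence "leads (g(y := p)) y v" using leads_step[of "g(y := p)" y v] by simp
    thus ?case using parent_maps_attach[OF g y v p] x by simp
  next
    case (3 f)
    thus ?case by simp
  next
    case (4 f)
    hence f: "f \<in> parent_maps (insert y U) Y" "leads f y v" by auto
    have vn: "v \<notin> insert y U" using v y by auto
    obtain h :: "'a \<Rightarrow> nat" where h: "\<And>u. u \<in> insert y U \<Longrightarrow> f u \<in> insert y (U \<union> Y)"
      "\<And>u. u \<in> insert y U \<Longrightarrow> h (f u) < h u" "\<And>u. u \<notin> insert y U \<Longrightarrow> f u = u"
      using f unfolding parent_maps_def by auto
    have "f(y := y) \<in> parent_maps U (insert y Y)"
      by (rule parent_mapsI[where h = h]) (use h y in auto)
    moreover have l: "leads (f(y := y)) (f y) v" by (rule leads_cut[OF f(1) vn f(2)])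
    moreover have "f y \<in> insert v U"
    proof (rule ccontr)
      assume n: "f y \<notin> insert v U"
      have "f y \<noteq> y" using h(2)[of y] by auto
      hence "(f(y := y)) (f y) = f y" using h(3) n by auto
      hence "v = f y" using l leads_fixed[where f = "f(y := y)" and z = "f y"] by blast
      thus False using n by simp
    qed
    ultimately show ?case by simp
  qed auto
  finally show ?thesis ..
qed

text \<open>
  Deleting the root \<open>v\<close> promotes its children \<open>D\<close> to roots.
\<close>

lemma sum_children:
  fixes U :: "'a set"
  assumes fin: "finite U" "finite Y" and disj: "U \<inter> Y = {}" and v: "v \<notin> U" "v \<notin> Y"
  shows "(\<Sum>g\<in>parent_maps U (insert v Y). F {u \<in> U. g u = v} g) =
    (\<Sum>D\<in>Pow U. \<Sum>g\<in>parent_maps (U - D) (Y \<union> D). F D (\<lambda>u. if u \<in> D then v else g u))"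
proof -
  have "(\<Sum>D\<in>Pow U. \<Sum>g\<in>parent_maps (U - D) (Y \<union> D). F D (\<lambda>u. if u \<in> D then v else g u)) =
    (\<Sum>(D, g)\<in>(SIGMA D:Pow U. parent_maps (U - D) (Y \<union> D)). F D (\<lambda>u. if u \<in> D then v else g u))"
    using fin by (intro sum.Sigma finite_parent_maps ballI) (auto intro: finite_subset)
  also have "\<dots> = (\<Sum>g\<in>parent_maps U (insert v Y). F {u \<in> U. g u = v} g)"
  proof (rule sum.reindex_bij_witness[where j = "\<lambda>(D, g) u. if u \<in> D then v else g u" and
          i = "\<lambda>g. ({u \<in> U. g u = v}, \<lambda>u. if g u = v then u else g u)"], goal_cases)
    case (1 x)
    obtain D g where x: "x = (D, g)" by force
    have D: "D \<subseteq> U" and g: "g \<in> parent_maps (U - D) (Y \<union> D)" using 1 x by auto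
    have gv: "g u = v \<longleftrightarrow> u = v" for u
      using parent_maps_in[OF g, of u] parent_maps_fix[OF g, of u] v D by (cases "u \<in> U - D") auto
    have gD: "g u = u" if "u \<in> D" for u using parent_maps_fix[OF g, of u] that by auto
    have gvv: "g v = v" using gv by simp
    show ?case using x D v by (auto simp: fun_eq_iff gv gvv gD)
  next
    case (2 x)
    obtain D g where x: "x = (D, g)" by force
    have D: "D \<subseteq> U" and g: "g \<in> parent_maps (U - D) (Y \<union> D)" using 2 x by auto
    obtain h :: "'a \<Rightarrow> nat" where h: "\<And>u. u \<in> U - D \<Longrightarrow> g u \<in> (U - D) \<union> (Y \<union> D)"
      "\<And>u. u \<notin> U - D \<Longrightarrow> g u = u" "\<And>u. u \<in> U - D \<Longrightarrow> h (g u) < h u"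
      using parent_mapsE[OF g] by metis
    have "(\<lambda>u. if u \<in> D then v else g u) \<in> parent_maps U (insert v Y)"
      by (rule parent_mapsI[where h = "\<lambda>u. if u = v then 0 else Suc (h u)"]) (use h D v in auto)
    thus ?case using x by simp
  next
    case (3 g)
    show ?case using parent_maps_fix[OF 3] v by (auto simp: fun_eq_iff)
  next
    case (4 g)
    obtain h :: "'a \<Rightarrow> nat" where h: "\<And>u. u \<in> U \<Longrightarrow> g u \<in> insert v (U \<union> Y)"
      "\<And>u. u \<in> U \<Longrightarrow> h (g u) < h u" "\<And>u. u \<notin> U \<Longrightarrow> g u = u"
      using 4 unfolding parent_maps_def by auto
    have "(\<lambda>u. if g u = v then u else g u) \<in> parent_maps (U - {u \<in> U. g u = v}) (Y \<union> {u \<in> U. g u = v})"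
      by (rule parent_mapsI[where h = h]) (use h v in auto)
    thus ?case by auto
  next
    case (5 x)
    obtain D g where x: "x = (D, g)" by force
    have D: "D \<subseteq> U" and g: "g \<in> parent_maps (U - D) (Y \<union> D)" using 5 x by auto
    have gv: "g u = v \<longleftrightarrow> u = v" for u
      using parent_maps_in[OF g, of u] parent_maps_fix[OF g, of u] v D by (cases "u \<in> U - D") auto
    have "{u \<in> U. (if u \<in> D then v else g u) = v} = D" using D gv v by auto
    thus ?case using x by simp
  qed
  finally show ?thesis ..
qed

section \<open>Exchangeability of the roots\<close>

definition edges_in :: "('a \<times> 'a) set \<Rightarrow> 'a set \<Rightarrow> ('a \<times> 'a) set" where
  "edges_in E U = E \<inter> U \<times> U"

definition relabel :: "'a set \<Rightarrow> ('a \<Rightarrow> 'a) \<Rightarrow> ('a \<Rightarrow> 'a) \<Rightarrow> 'a \<Rightarrow> 'a" where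
  "relabel U \<tau> f = (\<lambda>u. if u \<in> U then \<tau> (f u) else u)"

text \<open>
  Exchanging two roots only changes the edges leaving \<open>U\<close>, so it is invisible to everything that depends
  on the graph induced on \<open>U\<close>.
\<close>

lemma relabel_swap:
  fixes U :: "'a set"
  assumes f: "f \<in> parent_maps U Y" and disj: "U \<inter> Y = {}" and z: "z \<in> Y" "z' \<in> Y"
    and \<tau>: "\<tau> = Transposition.transpose z z'"
  shows "relabel U \<tau> f \<in> parent_maps U Y"
    and "relabel U \<tau> (relabel U \<tau> f) = f"
    and "u \<in> U \<Longrightarrow> leads f u z \<Longrightarrow> leads (relabel U \<tau> f) u z'"
    and "edges_in (edges (relabel U \<tau> f)) U = edges_in (edges f) U"
proof -
  obtain h :: "'a \<Rightarrow> nat" where h: "\<And>u. u \<in> U \<Longrightarrow> f u \<in> U \<union> Y"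
    "\<And>u. u \<in> U \<Longrightarrow> h (f u) < h u" "\<And>u. u \<notin> U \<Longrightarrow> f u = u"
    using f unfolding parent_maps_def by auto
  have \<tau>U: "\<tau> u = u" if "u \<in> U" for u
    using that z disj by (auto simp: \<tau> Transposition.transpose_def)
  have \<tau>UY: "\<tau> u \<in> U \<longleftrightarrow> u \<in> U" "\<tau> u \<in> Y \<longleftrightarrow> u \<in> Y" for u
    using z disj by (auto simp: \<tau> Transposition.transpose_def)
  have \<tau>\<tau>: "\<tau> (\<tau> u) = u" for u by (simp add: \<tau>)
  show "relabel U \<tau> f \<in> parent_maps U Y"
  proof (rule parent_mapsI[where h = "\<lambda>u. if u \<in> U then Suc (h u) else 0"], goal_cases)
    case (3 u)
    thus ?case using h(1,2)[of u] \<tau>U by (auto simp: relabel_def \<tau>UY)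
  qed (use h in \<open>auto simp: relabel_def \<tau>UY\<close>)
  show "relabel U \<tau> (relabel U \<tau> f) = f"
    using h(3) by (auto simp: relabel_def \<tau>\<tau>)
  show "edges_in (edges (relabel U \<tau> f)) U = edges_in (edges f) U"
  proof -
    have "\<tau> u = w \<longleftrightarrow> u = w" if "w \<in> U" for u w using \<tau>U \<tau>\<tau> that by metis
    thus ?thesis by (auto simp: edges_in_def edges_iff relabel_def)
  qed
  have "leads (relabel U \<tau> f) (\<tau> u) z'" if "(f ^^ k) u = z" for k u
    using that
  proof (induction k arbitrary: u)
    case 0
    thus ?case by (simp add: \<tau>)
  next
    case (Suc k)
    have "(f ^^ k) (f u) = z" using Suc.prems by (metis funpow_Suc_right o_apply)
    hence IH: "leads (relabel U \<tau> f) (\<tau> (f u)) z'" by (rule Suc.IH)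
    show ?case
    proof (cases "u \<in> U")
      case True
      hence "relabel U \<tau> f u = \<tau> (f u)" by (simp add: relabel_def)
      thus ?thesis using IH \<tau>U[OF True] leads_step by metis
    next
      case False
      thus ?thesis using IH h(3) by simp
    qed
  qed
  thus "u \<in> U \<Longrightarrow> leads f u z \<Longrightarrow> leads (relabel U \<tau> f) u z'"
    using \<tau>U unfolding leads_def by metis
qed

lemma sum_leads_root_eq:
  assumes disj: "U \<inter> Y = {}" and z: "z \<in> Y" "z' \<in> Y" and u: "u \<in> U"
  shows "(\<Sum>f | f \<in> parent_maps U Y \<and> leads f u z. F (edges_in (edges f) U)) =
         (\<Sum>f | f \<in> parent_maps U Y \<and> leads f u z'. F (edges_in (edges f) U))"
proof (rule sum.reindex_bij_witness[where i = "relabel U (Transposition.transpose z z')" and j = "relabel U (Transposition.transpose z z')"], goal_cases)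
  case (4 f)
  note R = relabel_swap[OF _ disj z(2) z(1) Transposition.transpose_commute]
  show ?case using R(1)[of f] R(3)[of f u] 4 u by simp
qed (use relabel_swap[OF _ disj z refl] u in auto)

lemma of_bool_leads_eq_sum:
  assumes f: "f \<in> parent_maps U Y" and disj: "U \<inter> Y = {}" and "D \<subseteq> Y" "finite D"
  shows "(of_bool (\<exists>d\<in>D. leads f u d) :: real) = (\<Sum>d\<in>D. of_bool (leads f u d))"
proof (cases "\<exists>d\<in>D. leads f u d")
  case True
  then obtain d where d: "d \<in> D" "leads f u d" by blast
  have fixed: "f e = e" if "e \<in> D" for e
    using parent_maps_fix[OF f, of e] disj assms(3) that by auto
  have "leads f u e \<longleftrightarrow> e = d" if "e \<in> D" for e
    using leads_unique[of f u e d] d fixed that by auto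
  hence "(\<Sum>e\<in>D. of_bool (leads f u e)) = (\<Sum>e\<in>D. of_bool (e = d) :: real)" by (intro sum.cong) auto
  thus ?thesis using True d assms(4) by (simp add: of_bool_def sum.delta)
qed auto

lemma sum_of_bool_filter:
  "finite A \<Longrightarrow> (\<Sum>x\<in>A. of_bool (P x) * F x) = (\<Sum>x | x \<in> A \<and> P x. F x :: real)"
  by (simp add: sum.inter_filter of_bool_def if_distrib[of "\<lambda>c. c * _"] cong: if_cong)

text \<open>
  By exchangeability of the roots, a vertex hangs below an element of \<open>D\<close> in the fraction
  \<open>|D| / |Y|\<close> of all cases, even when weighted by a function of the graph induced on \<open>U\<close>.
\<close>

lemma sum_leads_share:
  fixes F :: "('a \<times> 'a) set \<Rightarrow> real"
  assumes fin: "finite U" "finite Y" and disj: "U \<inter> Y = {}" and u: "u \<in> U" and D: "D \<subseteq> Y"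
  shows "(\<Sum>f\<in>parent_maps U Y. of_bool (\<exists>d\<in>D. leads f u d) * F (edges_in (edges f) U)) =
         card D / card Y * (\<Sum>f\<in>parent_maps U Y. F (edges_in (edges f) U))"
proof (cases "Y = {}")
  case True
  thus ?thesis using D u fin parent_maps_no_roots[of U] by auto
next
  case False
  then obtain z0 where z0: "z0 \<in> Y" by blast
  define S where "S = (\<Sum>f | f \<in> parent_maps U Y \<and> leads f u z0. F (edges_in (edges f) U))"
  have *: "(\<Sum>f\<in>parent_maps U Y. of_bool (\<exists>d\<in>D. leads f u d) * F (edges_in (edges f) U)) = card D * S"
    if D: "D \<subseteq> Y" for D
  proof -
    have "finite D" using D fin finite_subset by blast
    have "(\<Sum>f\<in>parent_maps U Y. of_bool (\<exists>d\<in>D. leads f u d) * F (edges_in (edges f) U)) =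
      (\<Sum>f\<in>parent_maps U Y. \<Sum>d\<in>D. of_bool (leads f u d) * F (edges_in (edges f) U))"
      using of_bool_leads_eq_sum[OF _ disj D \<open>finite D\<close>] by (intro sum.cong refl) (simp add: sum_distrib_right)
    also have "\<dots> = (\<Sum>d\<in>D. \<Sum>f\<in>parent_maps U Y. of_bool (leads f u d) * F (edges_in (edges f) U))"
      by (rule sum.swap)
    also have "\<dots> = (\<Sum>d\<in>D. \<Sum>f | f \<in> parent_maps U Y \<and> leads f u d. F (edges_in (edges f) U))"
      by (simp only: sum_of_bool_filter[OF finite_parent_maps[OF fin]])
    also have "\<dots> = (\<Sum>d\<in>D. S)"
      unfolding S_def using D z0 by (intro sum.cong refl sum_leads_root_eq disj u) auto
    finally show ?thesis by simp
  qed
  have "(\<Sum>f\<in>parent_maps U Y. F (edges_in (edges f) U)) =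
    (\<Sum>f\<in>parent_maps U Y. of_bool (\<exists>d\<in>Y. leads f u d) * F (edges_in (edges f) U))"
    using parent_maps_leads u by (intro sum.cong refl) fastforce
  also have "\<dots> = card Y * S" by (rule *) simp
  finally show ?thesis using *[OF D] False fin by simp
qed


section \<open>Removing a vertex and its neighbours\<close>

lemma edges_in_edges_in: "V \<subseteq> U \<Longrightarrow> edges_in (edges_in E U) V = edges_in E V"
  by (auto simp: edges_in_def)

text \<open>
  A quantity \<open>\<Phi>\<close> of the undetermined vertices and the graph on them, evaluated after the algorithm
  has activated \<open>v\<close>.
\<close>

definition after_removal :: "('a set \<Rightarrow> ('a \<times> 'a) set \<Rightarrow> real) \<Rightarrow> 'a \<Rightarrow> 'a set \<Rightarrow> ('a \<times> 'a) set \<Rightarrow> real" where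
  "after_removal \<Phi> v U E = (let W = U - insert v (E `` {v}) in \<Phi> W (edges_in E W))"

lemma after_removal_cong:
  assumes "edges_in E U = edges_in E' U" "v \<in> U"
  shows "after_removal \<Phi> v U E = after_removal \<Phi> v U E'"
proof -
  have "U - insert v (E `` {v}) = U - insert v (edges_in E U `` {v})" for E
    using assms(2) by (auto simp: edges_in_def)
  hence eq: "U - insert v (E `` {v}) = U - insert v (E' `` {v})" using assms(1) by metis
  have "edges_in E W = edges_in E' W" if "W \<subseteq> U" for W
    using edges_in_edges_in[OF that] assms(1) by metis
  thus ?thesis unfolding after_removal_def Let_def eq by auto
qed

text \<open>
  Let \<open>r \<in> Y\<close> be the root above \<open>v\<close>.  Rerooting at \<open>v\<close> makes \<open>r\<close> an ordinary vertex in the component of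
  \<open>v\<close>; cutting it off from its new parent \<open>p\<close> turns it back into a root.  The pair \<open>(r, p)\<close> is
  arbitrary apart from \<open>p\<close> lying in the component of \<open>v\<close>, which gives the factors \<open>card Y\<close> and the size of
  that component.
\<close>

lemma sum_reroot_removed:
  assumes fin: "finite U" "finite Y" and disj: "U \<inter> Y = {}" and v: "v \<in> U"
  shows "(\<Sum>f\<in>parent_maps U Y. after_removal \<Phi> v U (edges f)) =
    card Y * (\<Sum>g\<in>parent_maps (U - {v}) (insert v Y).
                card {p \<in> U. leads g p v} * after_removal \<Phi> v U (edges g))"
proof -
  let ?K = "after_removal \<Phi> v U"
  have "(\<Sum>f\<in>parent_maps U Y. ?K (edges f)) = (\<Sum>f\<in>parent_maps U Y. \<Sum>r\<in>Y. of_bool (leads f v r) * ?K (edges f))"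
  proof (intro sum.cong refl)
    fix f assume f: "f \<in> parent_maps U Y"
    have "(\<Sum>r\<in>Y. of_bool (leads f v r)) = (1 :: real)"
      using of_bool_leads_eq_sum[OF f disj order_refl fin(2), of v] parent_maps_leads[OF f, of v] v by auto
    thus "?K (edges f) = (\<Sum>r\<in>Y. of_bool (leads f v r) * ?K (edges f))"
      by (simp flip: sum_distrib_right)
  qed
  also have "\<dots> = (\<Sum>r\<in>Y. \<Sum>f\<in>parent_maps U Y. of_bool (leads f v r) * ?K (edges f))"
    by (rule sum.swap)
  also have "\<dots> = (\<Sum>r\<in>Y. \<Sum>f | f \<in> parent_maps U Y \<and> leads f v r. ?K (edges f))"
    by (simp only: sum_of_bool_filter[OF finite_parent_maps[OF fin]])
  also have "\<dots> = (\<Sum>r\<in>Y. \<Sum>g\<in>parent_maps (U - {v}) (insert v Y).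
                card {p \<in> U. leads g p v} * ?K (edges g))"
  proof (rule sum.cong[OF refl])
    fix r assume r: "r \<in> Y"
    have sets: "insert r (insert v (Y - {r})) = insert v Y" "insert v (U - {v}) = U" using r v by auto
    have "(\<Sum>f | f \<in> parent_maps U Y \<and> leads f v r. ?K (edges f)) =
      (\<Sum>g | g \<in> parent_maps (insert r (U - {v})) (insert v (Y - {r})) \<and> leads g r v. ?K (edges g))"
      by (rule sum_reroot[OF disj r v])
    also have "\<dots> = (\<Sum>g\<in>parent_maps (U - {v}) (insert v Y). \<Sum>p | p \<in> U \<and> leads g p v. ?K (edges (g(r := p))))"
      using sum_attach[of "U - {v}" "insert v (Y - {r})" r v "\<lambda>f. ?K (edges f)"] fin disj r v
      unfolding sets by auto
    also have "\<dots> = (\<Sum>g\<in>parent_maps (U - {v}) (insert v Y). \<Sum>p | p \<in> U \<and> leads g p v. ?K (edges g))"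
    proof -
      have "edges_in (edges (g(r := p))) U = edges_in (edges g) U" for g p
        using disjoint_iff[THEN iffD1, OF disj] r by (auto simp: edges_in_def edges_iff)
      hence "?K (edges (g(r := p))) = ?K (edges g)" for g p
        by (rule after_removal_cong[OF _ v])
      thus ?thesis by (simp only:)
    qed
    finally show "(\<Sum>f | f \<in> parent_maps U Y \<and> leads f v r. ?K (edges f)) =
      (\<Sum>g\<in>parent_maps (U - {v}) (insert v Y). card {p \<in> U. leads g p v} * ?K (edges g))" by simp
  qed
  finally show ?thesis by simp
qed

lemma leads_hang_below:
  assumes g: "g \<in> parent_maps (U - D) (Y \<union> D)" and disj: "U \<inter> Y = {}" and v: "v \<notin> U \<union> Y"
    and D: "D \<subseteq> U" and u: "u \<in> U - D"
  shows "leads (\<lambda>u. if u \<in> D then v else g u) u v \<longleftrightarrow> (\<exists>d\<in>D. leads g u d)"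
proof -
  let ?f = "\<lambda>u. if u \<in> D then v else g u"
  obtain h :: "'a \<Rightarrow> nat" where h: "\<And>u. u \<in> U - D \<Longrightarrow> g u \<in> (U - D) \<union> (Y \<union> D)"
    "\<And>u. u \<notin> U - D \<Longrightarrow> g u = u" "\<And>u. u \<in> U - D \<Longrightarrow> h (g u) < h u"
    using parent_mapsE[OF g] by metis
  have fv: "?f v = v" using h(2)[of v] v D by auto
  have "leads ?f w v \<longleftrightarrow> (\<exists>d\<in>D. leads g w d)" if "w \<in> U \<union> Y" for w
    using that
  proof (induction "h w" arbitrary: w rule: less_induct)
    case less
    show ?case
    proof (cases "w \<in> U - D")
      case True
      have fixed: "g d = d" if "d \<in> D" for d using h(2) that by auto
      have "leads ?f w v \<longleftrightarrow> leads ?f (?f w) v" using leads_step_iff[where f = ?f and z = v and u = w] fv by blast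
      also have "?f w = g w" using True by simp
      also have "leads ?f (g w) v \<longleftrightarrow> (\<exists>d\<in>D. leads g (g w) d)"
        using less.hyps[of "g w"] h(1,3)[OF True] D by auto
      also have "\<dots> \<longleftrightarrow> (\<exists>d\<in>D. leads g w d)" using leads_step_iff[where f = g] fixed by metis
      finally show ?thesis .
    next
      case False
      show ?thesis
      proof (cases "w \<in> D")
        case True
        have "leads ?f w v" using leads_step[of ?f w v] True by simp
        moreover have "\<exists>d\<in>D. leads g w d" using True by (auto intro!: bexI[of _ w])
        ultimately show ?thesis by blast
      next
        case wD: False
        hence "w \<in> Y" using False less.prems by auto
        hence "?f w = w" "g w = w" using wD h(2)[of w] disj by auto
        thus ?thesis using leads_fixed[where f = ?f and z = w] leads_fixed[where f = g and z = w] v wD less.prems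
          by metis
      qed
    qed
  qed
  thus ?thesis using u by blast
qed

lemma after_removal_hang_below:
  assumes g: "g \<in> parent_maps (U - {v} - D) (Y \<union> D)" and disj: "U \<inter> Y = {}" and v: "v \<in> U"
    and D: "D \<subseteq> U - {v}"
  shows "after_removal \<Phi> v U (edges (\<lambda>u. if u \<in> D then v else g u)) =
         \<Phi> (U - {v} - D) (edges_in (edges g) (U - {v} - D))"
proof -
  let ?f = "\<lambda>u. if u \<in> D then v else g u"
  have fv: "?f v = v" using parent_maps_fix[OF g, of v] D by auto
  have fu: "?f u = v \<longleftrightarrow> u \<in> D" if "u \<in> U - {v}" for u
    using parent_maps_in[OF g, of u] that disj v D by (cases "u \<in> D") auto
  have "(v, u) \<in> edges ?f \<longleftrightarrow> u \<in> D" if "u \<in> U - {v}" for u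
    unfolding edges_iff fv fu[OF that] using that by blast
  hence "U - insert v (edges ?f `` {v}) = U - {v} - D" by auto
  moreover have "edges_in (edges ?f) (U - {v} - D) = edges_in (edges g) (U - {v} - D)"
    by (auto simp: edges_in_def edges_iff)
  ultimately show ?thesis by (simp add: after_removal_def Let_def)
qed

text \<open>
  The size of the component of \<open>v\<close> counts \<open>v\<close>, its children \<open>D\<close>, and the remaining vertices hanging
  below \<open>D\<close>; by exchangeability each of the latter may be replaced by its average contribution
  \<open>card D / card (Y \<union> D)\<close>.
\<close>

theorem sum_removed_vertex:
  fixes \<Phi> :: "'a set \<Rightarrow> ('a \<times> 'a) set \<Rightarrow> real"
  assumes fin: "finite U" "finite Y" and disj: "U \<inter> Y = {}" and v: "v \<in> U"
  shows "(\<Sum>f\<in>parent_maps U Y. after_removal \<Phi> v U (edges f)) =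
    card Y * (\<Sum>D\<in>Pow (U - {v}). 
      (1 + card D + card (U - {v} - D) * (card D / card (Y \<union> D))) *
      (\<Sum>g\<in>parent_maps (U - {v} - D) (Y \<union> D). \<Phi> (U - {v} - D) (edges_in (edges g) (U - {v} - D))))"
proof -
  let ?K = "after_removal \<Phi> v U"
  let ?f = "\<lambda>D g u. if u \<in> D then v else g u"
  have "(\<Sum>g\<in>parent_maps (U - {v}) (insert v Y). card {p \<in> U. leads g p v} * ?K (edges g)) =
    (\<Sum>D\<in>Pow (U - {v}). \<Sum>g\<in>parent_maps (U - {v} - D) (Y \<union> D).
       card {p \<in> U. leads (?f D g) p v} * ?K (edges (?f D g)))"
    using sum_children[of "U - {v}" Y v "\<lambda>D g. card {p \<in> U. leads g p v} * ?K (edges g)"] fin disj v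
    by auto
  also have "\<dots> = (\<Sum>D\<in>Pow (U - {v}). (1 + card D + card (U - {v} - D) * (card D / card (Y \<union> D))) *
      (\<Sum>g\<in>parent_maps (U - {v} - D) (Y \<union> D). \<Phi> (U - {v} - D) (edges_in (edges g) (U - {v} - D))))"
  proof (rule sum.cong[OF refl])
    fix D assume "D \<in> Pow (U - {v})"
    hence D: "D \<subseteq> U - {v}" by simp
    define W where "W = U - {v} - D"
    define P where "P = parent_maps W (Y \<union> D)"
    define \<Psi> where "\<Psi> g = \<Phi> W (edges_in (edges g) W)" for g
    have fin': "finite W" "finite D" "finite (Y \<union> D)" using fin D finite_subset[of D U] by (auto simp: W_def)
    have disj': "W \<inter> (Y \<union> D) = {}" using disj by (auto simp: W_def)
    have "(\<Sum>g\<in>P. card {p \<in> U. leads (?f D g) p v} * ?K (edges (?f D g))) =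
      (\<Sum>g\<in>P. (1 + card D) * \<Psi> g + (\<Sum>u\<in>W. of_bool (\<exists>d\<in>D. leads g u d) * \<Psi> g))"
    proof (rule sum.cong[OF refl])
      fix g assume "g \<in> P"
      hence g: "g \<in> parent_maps (U - {v} - D) (Y \<union> D)" by (simp add: P_def W_def)
      have "{p \<in> U. leads (?f D g) p v} = insert v (D \<union> {u \<in> W. \<exists>d\<in>D. leads g u d})"
      proof -
        have "leads (?f D g) p v" if "p \<in> D" for p using leads_step[of "?f D g" p v] that by simp
        moreover have "leads (?f D g) u v \<longleftrightarrow> (\<exists>d\<in>D. leads g u d)" if "u \<in> W" for u
        proof -
          have "(U - {v}) \<inter> Y = {}" "v \<notin> (U - {v}) \<union> Y" using disj v by auto
          from leads_hang_below[OF g this D] show ?thesis using that by (simp add: W_def)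
        qed
        ultimately show ?thesis using v D by (auto simp: W_def)
      qed
      moreover have "card \<dots> = 1 + card D + card {u \<in> W. \<exists>d\<in>D. leads g u d}"
      proof -
        have "v \<notin> D \<union> {u \<in> W. \<exists>d\<in>D. leads g u d}" "D \<inter> {u \<in> W. \<exists>d\<in>D. leads g u d} = {}"
          using D by (auto simp: W_def)
        thus ?thesis using fin' by (simp add: card_Un_disjoint)
      qed
      moreover have "real (card {u \<in> W. \<exists>d\<in>D. leads g u d}) = (\<Sum>u\<in>W. of_bool (\<exists>d\<in>D. leads g u d))"
        using fin' by (simp add: of_bool_def sum.If_cases Int_def)
      moreover have "?K (edges (?f D g)) = \<Psi> g"
        using after_removal_hang_below[OF g disj v D] by (simp add: \<Psi>_def W_def)
      ultimately show "card {p \<in> U. leads (?f D g) p v} * ?K (edges (?f D g)) =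
        (1 + card D) * \<Psi> g + (\<Sum>u\<in>W. of_bool (\<exists>d\<in>D. leads g u d) * \<Psi> g)"
        by (simp add: distrib_right sum_distrib_right)
    qed
    also have "\<dots> = (1 + card D) * sum \<Psi> P + (\<Sum>u\<in>W. \<Sum>g\<in>P. of_bool (\<exists>d\<in>D. leads g u d) * \<Psi> g)"
      by (simp add: sum.distrib sum_distrib_left) (rule sum.swap)
    also have "(\<Sum>u\<in>W. \<Sum>g\<in>P. of_bool (\<exists>d\<in>D. leads g u d) * \<Psi> g) = (\<Sum>u\<in>W. card D / card (Y \<union> D) * sum \<Psi> P)"
      unfolding P_def \<Psi>_def by (intro sum.cong refl sum_leads_share fin' disj') auto
    finally show "(\<Sum>g\<in>parent_maps (U - {v} - D) (Y \<union> D). card {p \<in> U. leads (?f D g) p v} * ?K (edges (?f D g))) =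
      (1 + card D + card (U - {v} - D) * (card D / card (Y \<union> D))) *
      (\<Sum>g\<in>parent_maps (U - {v} - D) (Y \<union> D). \<Phi> (U - {v} - D) (edges_in (edges g) (U - {v} - D)))"
      unfolding P_def \<Psi>_def W_def by (simp add: distrib_right)
  qed
  finally show ?thesis using sum_reroot_removed[OF fin disj v, of \<Phi>] by simp
qed

text \<open>
  The first step on a tree: the tree is rooted at the chosen vertex itself, so nothing has to be
  rerooted and no multiplicity appears.
\<close>

theorem sum_removed_root:
  fixes \<Phi> :: "'a set \<Rightarrow> ('a \<times> 'a) set \<Rightarrow> real"
  assumes fin: "finite V" and v: "v \<in> V"
  shows "(\<Sum>f\<in>parent_maps (V - {v}) {v}. after_removal \<Phi> v V (edges f)) =
    (\<Sum>D\<in>Pow (V - {v}). \<Sum>g\<in>parent_maps (V - {v} - D) D. \<Phi> (V - {v} - D) (edges_in (edges g) (V - {v} - D)))"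
proof -
  let ?f = "\<lambda>D g u. if u \<in> D then v else g u"
  have "(\<Sum>f\<in>parent_maps (V - {v}) {v}. after_removal \<Phi> v V (edges f)) =
    (\<Sum>D\<in>Pow (V - {v}). \<Sum>g\<in>parent_maps (V - {v} - D) ({} \<union> D). after_removal \<Phi> v V (edges (?f D g)))"
    using sum_children[of "V - {v}" "{}" v "\<lambda>D g. after_removal \<Phi> v V (edges g)"] fin by auto
  also have "\<dots> = (\<Sum>D\<in>Pow (V - {v}). \<Sum>g\<in>parent_maps (V - {v} - D) ({} \<union> D).
      \<Phi> (V - {v} - D) (edges_in (edges g) (V - {v} - D)))"
    by (intro sum.cong refl after_removal_hang_below v) auto
  finally show ?thesis by simp
qed

section \<open>The greedy algorithm on a forest\<close>

text \<open>
  The probability that exactly \<open>k\<close> further vertices become active when \<open>U\<close> is undetermined.  Since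
  every step activates one vertex, the recursion on \<open>k\<close> follows the steps of the algorithm.  For
  \<open>U = {}\<close> and positive \<open>k\<close> the value is \<open>0 / 0 = 0\<close>, as it should be.
\<close>

primrec greedy_prob :: "nat \<Rightarrow> ('a \<times> 'a) set \<Rightarrow> 'a set \<Rightarrow> real" where
  "greedy_prob 0 E U = of_bool (U = {})"
| "greedy_prob (Suc k) E U = (\<Sum>v\<in>U. greedy_prob k E (U - insert v (E `` {v}))) / card U"

lemma pmf_card_greedy_run:
  assumes "finite U" "finite A" "A \<inter> U = {}"
  shows "pmf (map_pmf card (greedy_run G (U, A, B))) m =
    (if card A \<le> m then greedy_prob (m - card A) (parcs G) U else 0)"
  using assms
proof (induction U arbitrary: A B rule: finite_psubset_induct)
  case (psubset U)
  show ?case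
  proof (cases "U = {}")
    case True
    have "greedy_prob (m - card A) (parcs G) {} = of_bool (m \<le> card A)"
      by (cases "m - card A") auto
    thus ?thesis unfolding True by (subst greedy_run.simps) (auto simp: pmf_return)
  next
    case False
    have neigh: "neighbours G v = parcs G `` {v}" for v by (auto simp: neighbours_def)
    have "pmf (map_pmf card (greedy_run G (greedy_step G v (U, A, B)))) m =
      (if Suc (card A) \<le> m then greedy_prob (m - Suc (card A)) (parcs G) (U - insert v (parcs G `` {v})) else 0)"
      if v: "v \<in> U" for v
    proof -
      have "v \<notin> A" using psubset.prems v by auto
      hence "card (insert v A) = Suc (card A)" using psubset.prems by simp
      moreover have "U - insert v (parcs G `` {v}) \<subset> U" using v by auto
      moreover have "finite (insert v A)" "insert v A \<inter> (U - insert v (parcs G `` {v})) = {}"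
        using psubset.prems by auto
      ultimately show ?thesis
        using psubset.IH[of "U - insert v (parcs G `` {v})" "insert v A"] by (simp add: neigh)
    qed
    hence "pmf (map_pmf card (greedy_run G (U, A, B))) m =
      (\<Sum>v\<in>U. if Suc (card A) \<le> m then greedy_prob (m - Suc (card A)) (parcs G) (U - insert v (parcs G `` {v})) else 0) / card U"
      using False psubset.hyps
      by (simp add: greedy_run.simps[of G U] map_bind_pmf pmf_bind_pmf_of_set del: greedy_step.simps)
    also have "\<dots> = (if card A \<le> m then greedy_prob (m - card A) (parcs G) U else 0)"
    proof (cases "Suc (card A) \<le> m")
      case True
      hence "m - card A = Suc (m - Suc (card A))" by simp
      thus ?thesis using True by simp
    qed (use False in \<open>auto simp: not_less_eq_eq\<close>)
    finally show ?thesis .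
  qed
qed

lemma greedy_prob_edges_in: "greedy_prob k (edges_in E U) U = greedy_prob k E U"
proof (induction k arbitrary: E U)
  case (Suc k)
  have "greedy_prob k (edges_in E U) (U - insert v (edges_in E U `` {v})) =
        greedy_prob k E (U - insert v (E `` {v}))" if "v \<in> U" for v
  proof -
    have "U - insert v (edges_in E U `` {v}) = U - insert v (E `` {v})"
      using that by (auto simp: edges_in_def)
    moreover have "greedy_prob k (edges_in E U) W = greedy_prob k E W" if "W \<subseteq> U" for W
      using Suc[of "edges_in E U" W] Suc[of E W] edges_in_edges_in[OF that] by metis
    ultimately show ?thesis by auto
  qed
  thus ?case by simp
qed simp

lemma greedy_prob_Suc_after_removal:
  "greedy_prob (Suc k) E U = (\<Sum>v\<in>U. after_removal (\<lambda>W E. greedy_prob k E W) v U E) / card U"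
  by (simp add: after_removal_def Let_def greedy_prob_edges_in)

lemma sum_Pow_card:
  fixes F :: "nat \<Rightarrow> real"
  assumes "finite S"
  shows "(\<Sum>D\<in>Pow S. F (card D)) = (\<Sum>d\<le>card S. (card S choose d) * F d)"
proof -
  have "(\<Sum>D\<in>Pow S. F (card D)) = (\<Sum>d\<le>card S. \<Sum>D | D \<in> Pow S \<and> card D = d. F (card D))"
    using assms by (intro sum.group[symmetric]) (auto intro: card_mono)
  also have "\<dots> = (\<Sum>d\<le>card S. (card S choose d) * F d)"
    using n_subsets[OF assms] by (intro sum.cong refl) auto
  finally show ?thesis .
qed

lemma sum_binomial_affine:
  fixes a b x :: real
  shows "(\<Sum>d\<le>L. (L choose d) * ((a + b * d) * x ^ (L - d))) = a * (x + 1) ^ L + b * L * (x + 1) ^ (L - 1)"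
proof -
  have 1: "(\<Sum>d\<le>L. (L choose d) * x ^ (L - d)) = (x + 1) ^ L" for L
    using binomial_ring[of 1 x L] by (simp add: add.commute)
  have 2: "(\<Sum>d\<le>L. (L choose d) * (d * x ^ (L - d))) = L * (x + 1) ^ (L - 1)"
  proof (cases L)
    case (Suc M)
    have "(\<Sum>d\<le>Suc M. (Suc M choose d) * (d * x ^ (Suc M - d))) =
      (\<Sum>d\<le>M. (Suc M choose Suc d) * (Suc d * x ^ (M - d)))"
      by (subst sum.atMost_Suc_shift) simp
    also have "\<dots> = (\<Sum>d\<le>M. Suc M * ((M choose d) * x ^ (M - d)))"
    proof (intro sum.cong refl)
      fix d
      have "real (Suc M choose Suc d) * real (Suc d) = real (Suc M) * real (M choose d)"
        using Suc_times_binomial[of d M] by (metis of_nat_mult mult.commute)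
      thus "real (Suc M choose Suc d) * (real (Suc d) * x ^ (M - d)) = real (Suc M) * (real (M choose d) * x ^ (M - d))"
        by (simp only: mult.assoc[symmetric])
    qed
    also have "\<dots> = Suc M * (x + 1) ^ M" by (simp only: 1 flip: sum_distrib_left)
    finally show ?thesis using Suc by simp
  qed simp
  have "(\<Sum>d\<le>L. (L choose d) * ((a + b * d) * x ^ (L - d))) =
    a * (\<Sum>d\<le>L. (L choose d) * x ^ (L - d)) + b * (\<Sum>d\<le>L. (L choose d) * (d * x ^ (L - d)))"
    unfolding sum_distrib_left sum.distrib[symmetric]
    by (intro sum.cong refl) (simp add: algebra_simps)
  thus ?thesis by (simp add: 1 2)
qed

text \<open>
  For positive \<open>k\<close> this is the number of forests on \<open>N\<close> vertices hung on \<open>y\<close> given ones in which exactly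
  \<open>k\<close> of the \<open>N\<close> vertices have odd height; the number of
  activated vertices thus has the law of the number of vertices of odd height.
\<close>

definition greedy_weight :: "nat \<Rightarrow> nat \<Rightarrow> nat \<Rightarrow> real" where
  "greedy_weight N y k = (if k = 0 then of_bool (N = 0)
     else (N choose k) * (y * real k ^ (N - k) * real (N - k + y) ^ (k - 1)))"

text \<open>
  The sums over \<open>d\<close> collapse because \<open>(M - d) - Suc k + (y + d)\<close> does not depend on \<open>d\<close>: the power of this
  number comes out of the sum, and only a binomial sum over \<open>d\<close> is left.
\<close>

lemma sum_greedy_weight:
  fixes c :: "nat \<Rightarrow> real"
  shows "(\<Sum>d\<le>M. (M choose d) * (c d * greedy_weight (M - d) (y + d) (Suc k))) =
     (M choose Suc k) * real (M - Suc k + y) ^ k *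
     (\<Sum>d\<le>M - Suc k. (M - Suc k choose d) * (c d * (y + d) * real (Suc k) ^ (M - Suc k - d)))"
proof (cases "Suc k \<le> M")
  case True
  define L where "L = M - Suc k"
  have M: "M = L + Suc k" using True by (simp add: L_def)
  have "(\<Sum>d\<le>M. (M choose d) * (c d * greedy_weight (M - d) (y + d) (Suc k))) =
    (\<Sum>d\<le>L. (M choose d) * (c d * greedy_weight (M - d) (y + d) (Suc k)))"
    by (rule sum.mono_neutral_right) (auto simp: M greedy_weight_def)
  also have "\<dots> = (\<Sum>d\<le>L. (M choose Suc k) * real (L + y) ^ k * ((L choose d) * (c d * (y + d) * real (Suc k) ^ (L - d))))"
  proof (intro sum.cong refl)
    fix d assume "d \<in> {..L}"
    hence d: "d \<le> L" by simp
    have "(M choose d) * (M - d choose Suc k) = (M choose Suc k) * (L choose d)"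
      using choose_mult[of d "d + Suc k" M] choose_mult[of "Suc k" "d + Suc k" M]
        binomial_symmetric[of d "d + Suc k"] d
      by (simp add: M)
    hence "real (M choose d) * (M - d choose Suc k) = (M choose Suc k) * (L choose d)"
      by (metis of_nat_mult)
    moreover have "M - d - Suc k = L - d" "M - d - Suc k + (y + d) = L + y" using d by (auto simp: M)
    ultimately show "(M choose d) * (c d * greedy_weight (M - d) (y + d) (Suc k)) =
      (M choose Suc k) * real (L + y) ^ k * ((L choose d) * (c d * (y + d) * real (Suc k) ^ (L - d)))"
      by (simp add: greedy_weight_def mult_ac) 
  qed
  finally show ?thesis by (simp add: L_def sum_distrib_left)
next
  case False
  hence "M - d < Suc k" "M < Suc k" for d by auto
  hence "greedy_weight (M - d) (y + d) (Suc k) = 0" "M choose Suc k = 0" for d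
    by (simp_all add: greedy_weight_def binomial_eq_0)
  thus ?thesis by simp
qed

text \<open>
  The factor in front of the weight is the multiplicity of \<open>sum_removed_vertex\<close>.  Multiplied by the
  \<open>y + d\<close> contained in the weight it becomes affine in \<open>d\<close>.
\<close>

lemma greedy_weight_rec:
  "y * (\<Sum>d\<le>M. (M choose d) * ((1 + real d + real (M - d) * (d / real (y + d))) * greedy_weight (M - d) (y + d) k)) =
   greedy_weight (Suc M) y (Suc k)"
proof (cases k)
  case 0
  have "(\<Sum>d\<le>M. (M choose d) * ((1 + real d + real (M - d) * (d / real (y + d))) * greedy_weight (M - d) (y + d) k)) =
    (\<Sum>d\<in>{M}. (M choose d) * ((1 + real d + real (M - d) * (d / real (y + d))) * greedy_weight (M - d) (y + d) k))"
    by (rule sum.mono_neutral_right) (auto simp: 0 greedy_weight_def)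
  thus ?thesis by (simp add: 0 greedy_weight_def)
next
  case (Suc j)
  show ?thesis
  proof (cases "k \<le> M")
    case False
    hence "M - d < k" "Suc M < Suc k" for d by auto
    hence "greedy_weight (M - d) (y + d) k = 0" "greedy_weight (Suc M) y (Suc k) = 0" for d
      using Suc by (simp_all add: greedy_weight_def binomial_eq_0 del: binomial_Suc_Suc)
    thus ?thesis by simp
  next
    case True
    define L where "L = M - k"
    have M: "M = L + k" using True by (simp add: L_def)
    have coeff: "(1 + real d + real (M - d) * (d / real (y + d))) * (y + d) = real y + (real M + 1 + y) * d"
      if "d \<le> M" for d
      using that by (cases "y + d = 0") (auto simp: field_simps of_nat_diff)
    have "(\<Sum>d\<le>M. (M choose d) * ((1 + real d + real (M - d) * (d / real (y + d))) * greedy_weight (M - d) (y + d) k)) =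
      (M choose k) * real (L + y) ^ j * 
        (\<Sum>d\<le>L. (L choose d) * ((1 + real d + real (M - d) * (d / real (y + d))) * (y + d) * real k ^ (L - d)))"
      unfolding Suc by (subst sum_greedy_weight) (simp add: L_def Suc)
    also have "(\<Sum>d\<le>L. (L choose d) * ((1 + real d + real (M - d) * (d / real (y + d))) * (y + d) * real k ^ (L - d))) =
      (\<Sum>d\<le>L. (L choose d) * ((real y + (real M + 1 + y) * d) * real k ^ (L - d)))"
      using coeff by (intro sum.cong refl) (simp add: M)
    also have "\<dots> = y * real (Suc k) ^ L + (real M + 1 + y) * L * real (Suc k) ^ (L - 1)"
      by (subst sum_binomial_affine) (simp add: add.commute)
    finally have *: "(\<Sum>d\<le>M. (M choose d) * ((1 + real d + real (M - d) * (d / real (y + d))) * greedy_weight (M - d) (y + d) k)) =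
      (M choose k) * real (L + y) ^ j * (y * real (Suc k) ^ L + (real M + 1 + y) * L * real (Suc k) ^ (L - 1))" .
    have alg: "Suc k * (y * real (Suc k) ^ L + (real M + 1 + y) * L * real (Suc k) ^ (L - 1)) =
      Suc M * real (Suc k) ^ L * real (L + y)"
      by (cases L) (simp_all add: M algebra_simps)
    have "real (Suc k) * (Suc M choose Suc k) = Suc M * (M choose k)"
      using Suc_times_binomial[of k M] by (metis of_nat_mult)
    hence ch: "real (Suc M choose Suc k) = Suc M * (M choose k) / Suc k"
      by (simp add: field_simps)
    have "greedy_weight (Suc M) y (Suc k) = (Suc M choose Suc k) * (y * real (Suc k) ^ L * real (L + y) ^ k)"
      by (simp add: greedy_weight_def L_def)
    also have "\<dots> = y * ((M choose k) * real (L + y) ^ j * (Suc M * real (Suc k) ^ L * real (L + y) / Suc k))"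
      unfolding ch by (simp add: Suc field_simps)
    also have "\<dots> = y * ((M choose k) * real (L + y) ^ j * (y * real (Suc k) ^ L + (real M + 1 + y) * L * real (Suc k) ^ (L - 1)))"
      unfolding alg[symmetric] by simp
    finally show ?thesis unfolding * by simp
  qed
qed

text \<open>
  The generalized Cayley formula \<open>y (y + N)^(N - 1)\<close>, whose value 1 at \<open>N = 0\<close> would be spoilt by
  truncated subtraction.
\<close>

definition forest_number :: "nat \<Rightarrow> nat \<Rightarrow> real" where
  "forest_number N y = (if N = 0 then 1 else y * real (y + N) ^ (N - 1))"

lemma forest_number_rec:
  "y * (\<Sum>d\<le>M. (M choose d) * ((1 + real d + real (M - d) * (d / real (y + d))) * forest_number (M - d) (y + d))) =
   forest_number (Suc M) y"
proof (cases "y + M = 0")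
  case False
  define x where "x = real (y + M)"
  have x: "x > 0" using False unfolding x_def by (simp only: of_nat_0_less_iff)
  have "(1 + real d + real (M - d) * (d / real (y + d))) * forest_number (M - d) (y + d) =
    (y + real (Suc (y + M)) * d) * x ^ (M - d) / x" if "d \<le> M" for d
  proof (cases "d = M")
    case True
    thus ?thesis using x by (simp add: forest_number_def x_def field_simps)
  next
    case neq: False
    hence Md: "M - d = Suc (M - d - 1)" using that by simp
    have 1: "forest_number (M - d) (y + d) = (y + d) * (x ^ (M - d) / x)"
      using x neq that by (subst (2) Md) (simp add: forest_number_def x_def)
    have 2: "(1 + real d + real (M - d) * (d / real (y + d))) * (y + d) = y + real (Suc (y + M)) * d"
      using that by (cases "y + d = 0") (auto simp: field_simps of_nat_diff)
    show ?thesis unfolding 1 2[symmetric] by simp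
  qed
  hence "(\<Sum>d\<le>M. (M choose d) * ((1 + real d + real (M - d) * (d / real (y + d))) * forest_number (M - d) (y + d))) =
    (\<Sum>d\<le>M. (M choose d) * ((y + real (Suc (y + M)) * d) * x ^ (M - d))) / x"
    by (simp add: sum_divide_distrib)
  also have "\<dots> = (y * (x + 1) ^ M + (x + 1) * M * (x + 1) ^ (M - 1)) / x"
    by (subst sum_binomial_affine) (simp add: x_def algebra_simps)
  also have "\<dots> = (x + 1) ^ M"
  proof -
    have 1: "(x + 1) * M * (x + 1) ^ (M - 1) = M * (x + 1) ^ M" by (cases M) simp_all
    have 2: "y * (x + 1) ^ M + M * (x + 1) ^ M = x * (x + 1) ^ M"
      by (simp add: x_def distrib_right)
    show ?thesis unfolding 1 2 using x by simp
  qed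
  finally show ?thesis by (simp add: forest_number_def x_def add_ac)
qed (simp add: forest_number_def)

lemma sum_over_children:
  assumes fin: "finite U" "finite Y" and disj: "U \<inter> Y = {}" and v: "v \<in> U"
    and S: "\<And>W Z. finite W \<Longrightarrow> card W < card U \<Longrightarrow> finite Z \<Longrightarrow> W \<inter> Z = {} \<Longrightarrow> 
      (\<Sum>g\<in>parent_maps W Z. \<Phi> W (edges_in (edges g) W)) = (S (card W) (card Z) :: real)"
  shows "(\<Sum>f\<in>parent_maps U Y. after_removal \<Phi> v U (edges f)) =
     card Y * (\<Sum>d\<le>card U - 1. (card U - 1 choose d) *
       ((1 + real d + real (card U - 1 - d) * (d / real (card Y + d))) * S (card U - 1 - d) (card Y + d)))"
proof -
  let ?F = "\<lambda>d. (1 + real d + real (card U - 1 - d) * (d / real (card Y + d))) * S (card U - 1 - d) (card Y + d)"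
  have "(\<Sum>f\<in>parent_maps U Y. after_removal \<Phi> v U (edges f)) = card Y * (\<Sum>D\<in>Pow (U - {v}). ?F (card D))"
    unfolding sum_removed_vertex[OF fin disj v]
  proof (intro arg_cong[of _ _ "\<lambda>s. real (card Y) * s"] sum.cong[OF refl])
    fix D assume "D \<in> Pow (U - {v})"
    hence D: "D \<subseteq> U - {v}" "finite D" using fin finite_subset[of D U] by auto
    have "card (U - {v} - D) = card U - 1 - card D" using D fin v by (simp add: card_Diff_subset)
    moreover have "card (Y \<union> D) = card Y + card D"
      using D disj fin by (intro card_Un_disjoint) auto
    moreover have "card (U - {v} - D) < card U" using v fin by (intro psubset_card_mono) auto
    moreover have "(U - {v} - D) \<inter> (Y \<union> D) = {}" using disj by auto
    ultimately show "(1 + card D + card (U - {v} - D) * (card D / card (Y \<union> D))) *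
      (\<Sum>g\<in>parent_maps (U - {v} - D) (Y \<union> D). \<Phi> (U - {v} - D) (edges_in (edges g) (U - {v} - D))) = ?F (card D)"
      using S[of "U - {v} - D" "Y \<union> D"] fin D by simp
  qed
  also have "(\<Sum>D\<in>Pow (U - {v}). ?F (card D)) = (\<Sum>d\<le>card U - 1. (card U - 1 choose d) * ?F d)"
    using sum_Pow_card[of "U - {v}" ?F] fin v by simp
  finally show ?thesis .
qed

theorem card_parent_maps:
  assumes "finite U" "finite Y" "U \<inter> Y = {}"
  shows "card (parent_maps U Y) = forest_number (card U) (card Y)"
  using assms
proof (induction "card U" arbitrary: U Y rule: less_induct)
  case less
  show ?case
  proof (cases "U = {}")
    case True
    thus ?thesis by (simp add: forest_number_def parent_maps_empty)
  next
    case False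
    then obtain v where v: "v \<in> U" by blast
    define M where "M = card U - 1"
    have M: "card U = Suc M" using v less.prems(1) card_gt_0_iff[of U] by (auto simp: M_def)
    have "real (card (parent_maps U Y)) = (\<Sum>f\<in>parent_maps U Y. after_removal (\<lambda>_ _. 1) v U (edges f))"
      by (simp add: after_removal_def)
    also have "\<dots> = card Y * (\<Sum>d\<le>M. (M choose d) *
       ((1 + real d + real (M - d) * (d / real (card Y + d))) * forest_number (M - d) (card Y + d)))"
      using sum_over_children[OF less.prems v, of "\<lambda>_ _. 1" forest_number] less.hyps by (simp add: M)
    finally show ?thesis by (simp only: forest_number_rec M)
  qed
qed

theorem sum_greedy_prob:
  assumes "finite U" "finite Y" "U \<inter> Y = {}"
  shows "(\<Sum>f\<in>parent_maps U Y. greedy_prob k (edges f) U) = greedy_weight (card U) (card Y) k"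
  using assms
proof (induction k arbitrary: U Y)
  case 0
  show ?case
  proof (cases "U = {}")
    case False
    thus ?thesis using 0 by (auto simp: greedy_weight_def)
  qed (simp add: greedy_weight_def parent_maps_empty)
next
  case (Suc k)
  show ?case
  proof (cases "U = {}")
    case True
    thus ?thesis by (simp add: greedy_weight_def)
  next
    case False
    define M where "M = card U - 1"
    have M: "card U = Suc M" using False Suc.prems(1) card_gt_0_iff[of U] by (auto simp: M_def)
    let ?AR = "\<lambda>v f. after_removal (\<lambda>W E. greedy_prob k E W) v U (edges f)"
    have "(\<Sum>f\<in>parent_maps U Y. ?AR v f) = greedy_weight (card U) (card Y) (Suc k)" if v: "v \<in> U" for v
    proof -
      have "(\<Sum>f\<in>parent_maps U Y. ?AR v f) = card Y * (\<Sum>d\<le>M. (M choose d) *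
       ((1 + real d + real (M - d) * (d / real (card Y + d))) * greedy_weight (M - d) (card Y + d) k))"
        using sum_over_children[OF Suc.prems v, of "\<lambda>W E. greedy_prob k E W" "\<lambda>N y. greedy_weight N y k"]
          Suc.IH by (simp add: M greedy_prob_edges_in)
      thus ?thesis by (simp only: greedy_weight_rec M)
    qed
    moreover have "(\<Sum>f\<in>parent_maps U Y. greedy_prob (Suc k) (edges f) U) =
      (\<Sum>v\<in>U. \<Sum>f\<in>parent_maps U Y. ?AR v f) / card U"
      unfolding greedy_prob_Suc_after_removal
      by (subst sum.swap) (simp add: sum_divide_distrib)
    ultimately show ?thesis using M by simp
  qed
qed

text \<open>
  The set \<open>T\<close> of edge sets can be oriented towards any vertex.  Orienting it towards the vertex chosen
  first makes all first choices contribute the same amount.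
\<close>

theorem sum_greedy_prob_tree:
  assumes fin: "finite V" and V: "V \<noteq> {}" and
    T: "\<And>v. v \<in> V \<Longrightarrow> edges ` parent_maps (V - {v}) {v} = T"
  shows "(\<Sum>E\<in>T. greedy_prob (Suc k) E V) = 
    (card V - 1 choose k) * (real (card V - 1 - k) ^ k * real (Suc k) ^ (card V - 1 - k - 1))"
proof -
  define M where "M = card V - 1"
  let ?c = "(M choose k) * (real (M - k) ^ k * real (Suc k) ^ (M - k - 1))"
  let ?AR = "\<lambda>v E. after_removal (\<lambda>W E. greedy_prob k E W) v V E"
  have "(\<Sum>E\<in>T. ?AR v E) = ?c" if v: "v \<in> V" for v
  proof -
    have "inj_on edges (parent_maps (V - {v}) {v})"
      by (auto intro!: inj_onI dest: edges_determine_parent_map)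
    hence "(\<Sum>E\<in>T. ?AR v E) = (\<Sum>f\<in>parent_maps (V - {v}) {v}. ?AR v (edges f))"
      unfolding T[OF v, symmetric] by (simp add: sum.reindex)
    also have "\<dots> = (\<Sum>D\<in>Pow (V - {v}). greedy_weight (M - card D) (card D) k)"
      unfolding sum_removed_root[OF fin v]
    proof (rule sum.cong[OF refl])
      fix D assume "D \<in> Pow (V - {v})"
      hence D: "D \<subseteq> V - {v}" "finite D" using fin finite_subset[of D V] by auto
      have "card (V - {v} - D) = M - card D" using D fin v by (simp add: card_Diff_subset M_def)
      moreover have "(V - {v} - D) \<inter> D = {}" by auto
      ultimately show "(\<Sum>g\<in>parent_maps (V - {v} - D) D. greedy_prob k (edges_in (edges g) (V - {v} - D)) (V - {v} - D))
        = greedy_weight (M - card D) (card D) k"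
        using sum_greedy_prob[of "V - {v} - D" D k] fin D by (simp add: greedy_prob_edges_in)
    qed
    also have "\<dots> = (\<Sum>d\<le>M. (M choose d) * (1 * greedy_weight (M - d) (0 + d) k))"
      using sum_Pow_card[of "V - {v}" "\<lambda>d. greedy_weight (M - d) d k"] fin v by (simp add: M_def)
    also have "\<dots> = ?c"
    proof (cases k)
      case 0
      have "(\<Sum>d\<le>M. (M choose d) * (1 * greedy_weight (M - d) (0 + d) k)) =
        (\<Sum>d\<in>{M}. (M choose d) * (1 * greedy_weight (M - d) (0 + d) k))"
        by (rule sum.mono_neutral_right) (auto simp: 0 greedy_weight_def)
      thus ?thesis by (simp add: 0 greedy_weight_def)
    next
      case (Suc j)
      have "(\<Sum>d\<le>M. (M choose d) * (1 * greedy_weight (M - d) (0 + d) k)) =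
        (M choose k) * real (M - k) ^ j * (\<Sum>d\<le>M - k. (M - k choose d) * ((0 + 1 * d) * real k ^ (M - k - d)))"
        unfolding Suc by (subst sum_greedy_weight) simp
      also have "\<dots> = (M choose k) * real (M - k) ^ j * (real (M - k) * real (Suc k) ^ (M - k - 1))"
        using sum_binomial_affine[of "M - k" 0 1 "real k"] by (simp add: add.commute)
      finally show ?thesis by (simp add: Suc)
    qed
    finally show ?thesis .
  qed
  moreover have "(\<Sum>E\<in>T. greedy_prob (Suc k) E V) = (\<Sum>v\<in>V. \<Sum>E\<in>T. ?AR v E) / card V"
    unfolding greedy_prob_Suc_after_removal by (subst sum.swap) (simp add: sum_divide_distrib)
  ultimately show ?thesis using fin V by (simp add: M_def)
qed

section \<open>Trees as parent maps\<close>

lemma pcas_conv: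
  assumes "pcas u p v" "p \<noteq> []"
  shows "pawalk_verts u p = u # map snd p" "fst (p ! 0) = u" "snd (last p) = v"
    "Suc i < length p \<Longrightarrow> fst (p ! Suc i) = snd (p ! i)"
proof -
  show "pawalk_verts u p = u # map snd p" using assms(1) by (induction p arbitrary: u) auto
  show "fst (p ! 0) = u" using assms by (cases p) auto
  show "snd (last p) = v" using assms
  proof (induction p arbitrary: u)
    case (Cons a p)
    thus ?case by (cases p) auto
  qed simp
  show "Suc i < length p \<Longrightarrow> fst (p ! Suc i) = snd (p ! i)" using assms
  proof (induction p arbitrary: u i)
    case (Cons a p)
    thus ?case by (cases i; cases p) auto
  qed simp
qed

lemma parent_maps_edge_up:
  fixes h :: "'a \<Rightarrow> nat"
  assumes "\<And>u. u \<in> U \<Longrightarrow> h (f u) < h u" "\<And>u. u \<notin> U \<Longrightarrow> f u = u"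
    and "(a, b) \<in> edges f" "h b \<le> h a"
  shows "f a = b"
  using assms unfolding edges_iff by (metis linorder_not_le)

text \<open>
  A vertex of maximal rank on a cycle has its parent on both sides, so its two neighbours on the cycle
  coincide; in a cycle of length at least 3 they are different.
\<close>

lemma no_long_cycle:
  fixes U :: "'a set"
  assumes f: "f \<in> parent_maps U Y" and p: "set p \<subseteq> edges f" "pcas u p u" "distinct (map snd p)" and len: "length p \<ge> 3"
  shows False
proof -
  obtain h :: "'a \<Rightarrow> nat" where h: "\<And>u. u \<in> U \<Longrightarrow> h (f u) < h u" "\<And>u. u \<notin> U \<Longrightarrow> f u = u"
    using parent_mapsE[OF f] by metis
  define n where "n = length p"
  have ne: "p \<noteq> []" using len by auto
  note conv = pcas_conv[OF p(2) ne]
  have step: "fst (p ! (Suc i mod n)) = snd (p ! i)" if "i < n" for i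
  proof (cases "Suc i < n")
    case True
    thus ?thesis using conv(4)[of i] by (simp add: n_def)
  next
    case False
    hence "n = Suc i" using that by simp
    moreover have "last p = p ! i" using \<open>n = Suc i\<close> ne by (simp add: n_def last_conv_nth)
    ultimately show ?thesis using conv(2,3) by simp
  qed
  obtain i where i: "i < n" "\<And>j. j < n \<Longrightarrow> h (snd (p ! j)) \<le> h (snd (p ! i))"
  proof -
    have "finite ((\<lambda>j. h (snd (p ! j))) ` {..<n})" "(\<lambda>j. h (snd (p ! j))) ` {..<n} \<noteq> {}"
      using len by (auto simp: n_def lessThan_empty_iff)
    from Max_in[OF this] Max_ge[OF this(1)] that show ?thesis by (smt (verit) imageE imageI lessThan_iff)
  qed
  have nn: "n \<ge> 3" using len by (simp add: n_def)
  define j where "j = (i + n - 1) mod n"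
  define k where "k = Suc i mod n"
  have jk: "j < n" "k < n" using nn by (auto simp: j_def k_def)
  have ji: "Suc j mod n = i"
  proof -
    have "Suc j mod n = Suc (i + n - 1) mod n" by (simp add: j_def mod_Suc_eq)
    also have "Suc (i + n - 1) = i + n" using nn by simp
    finally show ?thesis using i(1) by simp
  qed
  have edge: "(snd (p ! j), snd (p ! (Suc j mod n))) \<in> edges f" if "j < n" for j
  proof -
    have "Suc j mod n < n" using nn by simp
    hence "p ! (Suc j mod n) \<in> edges f" using p(1) by (metis n_def nth_mem subsetD)
    thus ?thesis using step[OF that] by (metis prod.collapse)
  qed
  have "f (snd (p ! i)) = snd (p ! k)"
    using parent_maps_edge_up[where U = U and h = h and f = f, OF h edge[OF i(1)]] i(2)[OF jk(2)] by (simp add: k_def)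
  moreover have "f (snd (p ! i)) = snd (p ! j)"
  proof -
    have "(snd (p ! i), snd (p ! j)) \<in> edges f"
      using edge[OF jk(1)] sym_edges[of f] unfolding ji by (meson symE)
    from parent_maps_edge_up[where U = U and h = h and f = f, OF h this] i(2)[OF jk(1)] show ?thesis by simp
  qed
  ultimately have "j = k"
    using p(3) jk by (metis distinct_conv_nth length_map n_def nth_map)
  have "k = (if Suc i = n then 0 else Suc i)" using i(1) by (auto simp: k_def)
  moreover have "j = (if i = 0 then n - 1 else i - 1)"
    using i(1) nn by (auto simp: j_def mod_if)
  ultimately show False using \<open>j = k\<close> nn i(1) by (auto split: if_splits)
qed

lemma undirected_tree_edges:
  fixes V :: "'a set"
  assumes fin: "finite V" and r: "r \<in> V" and f: "f \<in> parent_maps (V - {r}) {r}"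
  shows "undirected_tree \<lparr>pverts = V, parcs = edges f\<rparr>" (is "undirected_tree ?T")
proof -
  have ends: "a \<in> V \<and> f a \<in> V" if "f a \<noteq> a" for a
    using parent_maps_fix[OF f, of a] parent_maps_in[OF f, of a] r that by (cases "a \<in> V - {r}") auto
  have "a \<in> V \<and> b \<in> V" if "(a, b) \<in> edges f" for a b
  proof -
    from that consider "f a = b" "f a \<noteq> a" | "f b = a" "f b \<noteq> b" by (auto simp: edges_iff)
    thus ?thesis by cases (use ends[of a] ends[of b] in simp_all)
  qed
  hence sub: "edges f \<subseteq> V \<times> V" by auto
  interpret pair_graph ?T
  proof unfold_locales
    show "symmetric (with_proj ?T)" by (simp add: symmetric_def sym_edges)
    show "finite (parcs ?T)" using sub fin by (simp add: finite_subset)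
  qed (use sub fin in \<open>auto simp: edges_def\<close>)
  have to_root: "u \<rightarrow>\<^sup>*\<^bsub>with_proj ?T\<^esub> r" if "u \<in> V" for u
  proof -
    have "leads f u r" using parent_maps_leads[OF f, of u] that by auto
    hence "(u, r) \<in> (edges f)\<^sup>*" by (rule leads_rtrancl)
    thus ?thesis
    proof (induction rule: converse_rtrancl_induct)
      case base
      show ?case using r by auto
    next
      case (step a b)
      have "a \<rightarrow>\<^bsub>with_proj ?T\<^esub> b" using step(1) by simp
      thus ?case using adj_reachable_trans[of a b r] step by simp
    qed
  qed
  have "symmetric (with_proj ?T)" by (simp add: symmetric_def sym_edges)
  have reach: "u \<rightarrow>\<^sup>*\<^bsub>with_proj ?T\<^esub> v" if "u \<in> V" "v \<in> V" for u v
    using reachable_trans[OF to_root[OF that(1)] symmetric_reachable[OF \<open>symmetric (with_proj ?T)\<close> to_root[OF that(2)]]] .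
  have "Digraph_Component.connected (with_proj ?T)"
    using r reach by (auto simp: Digraph_Component.connected_def strongly_connected_def intro!: reachable_mk_symmetricI)
  moreover have False if "pre_digraph.cycle (with_proj ?T) p" "length p \<ge> 3" for p
  proof -
    from that(1) obtain u where u: "set p \<subseteq> edges f" "pcas u p u" "distinct (tl (pawalk_verts u p))" "p \<noteq> []"
      unfolding pre_digraph.cycle_def pre_digraph.awalk_def
      by (auto simp: cas_with_proj_eq awalk_verts_with_proj_eq)
    have "distinct (map snd p)" using u(3) pcas_conv(1)[OF u(2,4)] by simp
    from no_long_cycle[OF f u(1,2) this that(2)] show False .
  qed
  ultimately show ?thesis
    using pair_graph_axioms unfolding undirected_tree_def by blast
qed

text \<open>
  Every vertex chooses a neighbour that is closer to \<open>r\<close>.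
\<close>

lemma ex_spanning_parent_map:
  fixes V :: "'a set"
  assumes E: "E \<subseteq> V \<times> V" and conn: "\<And>u. u \<in> V \<Longrightarrow> (u, r) \<in> E\<^sup>*" and sym: "sym E" and r: "r \<in> V"
  shows "\<exists>f \<in> parent_maps (V - {r}) {r}. edges f \<subseteq> E"
proof -
  define h where "h u = (LEAST k. (u, r) \<in> E ^^ k)" for u
  have closer: "\<exists>w. (u, w) \<in> E \<and> h w < h u" if u: "u \<in> V - {r}" for u
  proof -
    have "(u, r) \<in> E ^^ h u"
      unfolding h_def using conn[of u] u by (metis DiffD1 LeastI_ex rtrancl_imp_relpow)
    moreover from this have "h u \<noteq> 0" using u by (metis DiffD2 IdD relpow.simps(1) singletonI)
    then obtain k where k: "h u = Suc k" using not0_implies_Suc by blast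
    ultimately obtain w where w: "(u, w) \<in> E" "(w, r) \<in> E ^^ k" by (metis relpow_Suc_E2)
    hence "h w \<le> k" unfolding h_def by (intro Least_le)
    thus ?thesis using w k by auto
  qed
  define f where "f u = (if u \<in> V - {r} then SOME w. (u, w) \<in> E \<and> h w < h u else u)" for u
  have f: "(u, f u) \<in> E \<and> h (f u) < h u" if "u \<in> V - {r}" for u
    using someI_ex[OF closer[OF that]] that by (simp add: f_def)
  have "f \<in> parent_maps (V - {r}) {r}"
  proof (rule parent_mapsI[where h = h], goal_cases)
    case (1 u)
    thus ?case using f[OF 1] E by auto
  next
    case (2 u)
    thus ?case by (simp only: f_def if_False)
  next
    case (3 u)
    thus ?case using f[OF 3] by simp
  qed
  moreover have "edges f \<subseteq> E"
  proof -
    have up: "(u, f u) \<in> E" if "f u \<noteq> u" for u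
    proof -
      have "u \<in> V - {r}" using that unfolding f_def by presburger
      thus ?thesis using f by blast
    qed
    show ?thesis
    proof
      fix e assume "e \<in> edges f"
      then obtain a b where e: "e = (a, b)" "a \<noteq> b" "f a = b \<or> f b = a" by (auto simp: edges_def)
      thus "e \<in> E" using up[of a] up[of b] sym by (auto dest: symD)
    qed
  qed
  ultimately show ?thesis by blast
qed

lemma parent_path:
  fixes U :: "'a set"
  assumes g: "g \<in> parent_maps U {a}" and b: "leads g b a"
  obtains k where "(g ^^ k) b = a" "distinct (map (\<lambda>i. (g ^^ i) b) [0..<Suc k])" 
    "\<And>i. i < k \<Longrightarrow> ((g ^^ i) b, (g ^^ Suc i) b) \<in> edges g"
proof -
  obtain h :: "'a \<Rightarrow> nat" where h: "\<And>u. u \<in> U \<Longrightarrow> g u \<in> U \<union> {a}" "\<And>u. u \<in> U \<Longrightarrow> h (g u) < h u" "\<And>u. u \<notin> U \<Longrightarrow> g u = u"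
    using parent_mapsE[OF g] by metis
  define k where "k = (LEAST k. (g ^^ k) b = a)"
  obtain k0 where "(g ^^ k0) b = a" using b by (auto simp: leads_def)
  hence k: "(g ^^ k) b = a" unfolding k_def by (rule LeastI)
  have neq: "(g ^^ i) b \<noteq> a" if "i < k" for i using that not_less_Least unfolding k_def by blast
  have U: "(g ^^ i) b \<in> U" if "i < k" for i
  proof (rule ccontr)
    assume "(g ^^ i) b \<notin> U"
    hence "(g ^^ (k - i)) ((g ^^ i) b) = (g ^^ i) b" using h(3) funpow_fix[where f = g and z = "(g ^^ i) b"] by blast
    hence "(g ^^ k) b = (g ^^ i) b" using that by (metis funpow_add comp_apply le_add_diff_inverse2 less_imp_le)
    thus False using k neq[OF that] by simp
  qed
  have "distinct (map (\<lambda>i. (g ^^ i) b) [0..<Suc k])"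
  proof -
    have dec: "h ((g ^^ j) b) < h ((g ^^ i) b)" if "i < j" "j \<le> k" for i j
      using that
    proof (induction j)
      case (Suc j)
      have "h ((g ^^ Suc j) b) < h ((g ^^ j) b)" using h(2)[OF U[of j]] Suc.prems by simp
      thus ?case using Suc by (cases "i = j") auto
    qed simp
    have "inj_on (\<lambda>i. (g ^^ i) b) {0..<Suc k}"
    proof (rule linorder_inj_onI')
      fix i j assume "i \<in> {0..<Suc k}" "j \<in> {0..<Suc k}" "i < j"
      thus "(g ^^ i) b \<noteq> (g ^^ j) b" using dec[of i j] by force
    qed
    thus ?thesis by (simp add: distinct_map del: upt_Suc)
  qed
  moreover have "((g ^^ i) b, (g ^^ Suc i) b) \<in> edges g" if "i < k" for i
    using h(2)[OF U[OF that]] by (auto simp: edges_iff)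
  ultimately show ?thesis using that k by blast
qed

text \<open>
  A spanning parent map exists by connectedness.  An edge \<open>(a, b)\<close> that it misses would close a cycle with
  the path of parents from \<open>b\<close> to \<open>a\<close> after rerooting at \<open>a\<close>, and this path has length at least 2.
\<close>

lemma undirected_tree_parent_map:
  fixes T :: "'a pair_pre_digraph"
  assumes T: "undirected_tree T" and r: "r \<in> pverts T"
  shows "parcs T \<in> edges ` parent_maps (pverts T - {r}) {r}"
proof -
  define V where "V = pverts T"
  have r: "r \<in> V" using r by (simp add: V_def)
  interpret pair_graph T using T by (simp add: undirected_tree_def)
  have sub: "parcs T \<subseteq> V \<times> V" using in_arcsD1 in_arcsD2 by (force simp: V_def)
  have symm: "sym (parcs T)" using pair_sym_arcs by (simp add: symmetric_def)
  have conn: "(u, v) \<in> (parcs T)\<^sup>*" if "u \<in> V" "v \<in> V" for u v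
  proof -
    have "u \<rightarrow>\<^sup>*\<^bsub>with_proj (mk_symmetric (with_proj T))\<^esub> v"
      using T that by (auto simp: undirected_tree_def Digraph_Component.connected_def strongly_connected_def V_def)
    hence "u \<rightarrow>\<^sup>*\<^bsub>with_proj T\<^esub> v"
      using pair_sym_arcs reachable_mk_symmetric_eq by blast
    thus ?thesis using reachable_rtranclI[of "with_proj T" u v] by simp
  qed
  obtain f where f: "f \<in> parent_maps (V - {r}) {r}" "edges f \<subseteq> parcs T"
    using ex_spanning_parent_map[OF sub conn[OF _ r] symm r] by blast
  have "(a, b) \<in> edges f" if ab: "(a, b) \<in> parcs T" for a b
  proof (rule ccontr)
    assume nab: "(a, b) \<notin> edges f"
    have neq: "a \<noteq> b" using pair_no_loops[OF ab] by simp
    have V: "a \<in> V" "b \<in> V" using ab sub by auto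
    have "leads f u r" if "u \<in> V" for u using parent_maps_leads[OF f(1), of u] that by auto
    hence "(r, a) \<in> (edges f)\<^sup>*"
      using leads_rtrancl[of f a r] V sym_rtrancl[OF sym_edges, of f] by (meson symE)
    from reroot[OF f(1) _ _ this] obtain g where "g \<in> parent_maps (insert r (V - {r}) - {a}) (insert a ({r} - {r}))" "edges g = edges f" by auto
    moreover have "insert r (V - {r}) - {a} = V - {a}" using r by auto
    ultimately have g: "g \<in> parent_maps (V - {a}) {a}" "edges g = edges f" by auto
    have "leads g b a" using parent_maps_leads[OF g(1), of b] V by auto
    then obtain k where k: "(g ^^ k) b = a" "distinct (map (\<lambda>i. (g ^^ i) b) [0..<Suc k])"
      "\<And>i. i < k \<Longrightarrow> ((g ^^ i) b, (g ^^ Suc i) b) \<in> edges g"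
      using parent_path[OF g(1)] by metis
    have "k \<noteq> 0" using k(1) neq by (metis funpow_0)
    moreover have "k \<noteq> 1"
    proof
      assume "k = 1"
      hence "g b = a" using k(1) by simp
      hence "(a, b) \<in> edges g" using neq by (simp add: edges_iff)
      thus False using nab g(2) by simp
    qed
    ultimately have k2: "k \<ge> 2" by simp
    define p where "p = (a, b) # map (\<lambda>i. ((g ^^ i) b, (g ^^ Suc i) b)) [0..<k]"
    have path: "pcas ((g ^^ i) b) (map (\<lambda>i. ((g ^^ i) b, (g ^^ Suc i) b)) [i..<k]) ((g ^^ k) b)" if "i \<le> k" for i
      using that
    proof (induction rule: inc_induct)
      case (step i)
      thus ?case by (simp add: upt_rec[of i k])
    qed simp
    have "pcas a p a" using path[of 0] k(1) by (simp add: p_def)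
    moreover have "map snd p = map (\<lambda>i. (g ^^ i) b) [0..<Suc k]"
      unfolding p_def by (subst upt_conv_Cons) (simp_all add: map_Suc_upt[symmetric] del: upt_Suc)
    hence "distinct (tl (pawalk_verts a p))"
      using pcas_conv(1)[OF \<open>pcas a p a\<close>] k(2) by (simp add: p_def)
    moreover have "set p \<subseteq> parcs T" using ab k(3) f(2) g(2) by (auto simp: p_def)
    moreover have "a \<in> pverts T" "p \<noteq> []" using V by (simp_all add: V_def p_def)
    ultimately have "pre_digraph.cycle (with_proj T) p"
      unfolding pre_digraph.cycle_def pre_digraph.awalk_def cas_with_proj_eq awalk_verts_with_proj_eq
        with_proj_simps using \<open>pcas a p a\<close> by blast
    moreover have "length p \<ge> 3" using k2 by (simp add: p_def)
    ultimately show False using T by (auto simp: undirected_tree_def)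
  qed
  hence "parcs T = edges f" using f(2) by auto
  thus ?thesis using f(1) by (auto simp: V_def)
qed

theorem parcs_cayley_trees:
  assumes "r \<in> {1..n}"
  shows "edges ` parent_maps ({1..n} - {r}) {r} = parcs ` cayley_trees n"
proof
  show "edges ` parent_maps ({1..n} - {r}) {r} \<subseteq> parcs ` cayley_trees n"
  proof
    fix E assume "E \<in> edges ` parent_maps ({1..n} - {r}) {r}"
    then obtain f where f: "f \<in> parent_maps ({1..n} - {r}) {r}" "E = edges f" by auto
    have "\<lparr>pverts = {1..n}, parcs = E\<rparr> \<in> cayley_trees n"
      using undirected_tree_edges[OF _ assms f(1)] f(2) by (simp add: cayley_trees_def)
    thus "E \<in> parcs ` cayley_trees n" by (rule rev_image_eqI) simp
  qed
  show "parcs ` cayley_trees n \<subseteq> edges ` parent_maps ({1..n} - {r}) {r}"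
  proof
    fix E assume "E \<in> parcs ` cayley_trees n"
    then obtain T where T: "E = parcs T" "pverts T = {1..n}" "undirected_tree T"
      by (auto simp: cayley_trees_def)
    show "E \<in> edges ` parent_maps ({1..n} - {r}) {r}"
      using undirected_tree_parent_map[OF T(3), of r] assms T by simp
  qed
qed

lemma inj_on_parcs_cayley_trees: "inj_on parcs (cayley_trees n)"
  by (auto intro!: inj_onI simp: cayley_trees_def)

section \<open>Stirling's formula\<close>

definition stirling_error :: "nat \<Rightarrow> real" where
  "stirling_error n = ln (fact n) - ((n + 1 / 2) * ln n - n + ln (2 * pi) / 2)"

lemma fact_stirling_error:
  assumes "n \<ge> 1"
  shows "fact n = exp (stirling_error n) * (sqrt (2 * pi * n) * real n ^ n * exp (- real n))"
proof -
  have "ln (fact n :: real) = stirling_error n + (ln (2 * pi * n) / 2 + n * ln n - n)"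
    using assms by (simp add: stirling_error_def ln_mult algebra_simps)
  also have "\<dots> = ln (exp (stirling_error n) * (sqrt (2 * pi * n) * real n ^ n * exp (- real n)))"
    using assms by (simp add: ln_mult ln_sqrt ln_realpow)
  finally show ?thesis using assms by simp
qed

text \<open>
  The increments are of order \<open>1 / n\<^sup>2\<close>, hence summable.
\<close>

lemma stirling_error_convergent: "convergent stirling_error"
proof -
  define g :: "nat \<Rightarrow> real" where "g n = (n + 1 / 2) * ln (1 + 1 / n) - 1" for n
  have step: "stirling_error (Suc (Suc n)) - stirling_error (Suc n) = - g (Suc n)" for n
  proof -
    have "ln (1 + 1 / real (Suc n)) = ln (real (Suc (Suc n))) - ln (real (Suc n))"
    proof -
      have "1 + 1 / real (Suc n) = real (Suc (Suc n)) / real (Suc n)" by (simp add: field_simps)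
      thus ?thesis by (simp add: ln_div del: of_nat_Suc)
    qed
    moreover have "ln (fact (Suc (Suc n)) :: real) = ln (real (Suc (Suc n))) + ln (fact (Suc n))"
      by (subst fact_Suc) (simp add: ln_mult del: of_nat_Suc fact_Suc)
    ultimately show ?thesis
      unfolding stirling_error_def g_def by (simp only:) (simp add: algebra_simps del: fact_Suc)
  qed
  have "(\<lambda>n. - g (Suc n)) \<in> O(\<lambda>n. 1 / real n ^ 2)"
    unfolding g_def by real_asymp
  hence "summable (\<lambda>n. - g (Suc n))"
    by (rule summable_comparison_test_bigo[rotated])
      (use inverse_power_summable[of 2, where 'a = real] in \<open>simp add: field_simps\<close>)
  hence "convergent (\<lambda>n. \<Sum>i<n. stirling_error (Suc (Suc i)) - stirling_error (Suc i))"
    unfolding step by (simp add: summable_iff_convergent)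
  hence "convergent (\<lambda>n. stirling_error (Suc n) - stirling_error (Suc 0))"
    by (simp add: sum_lessThan_telescope[of "\<lambda>n. stirling_error (Suc n)"])
  hence "convergent (\<lambda>n. stirling_error (Suc n))"
    by (simp add: convergent_diff_const_right_iff)
  thus ?thesis by (simp only: convergent_Suc_iff)
qed

lemma wallis_prod:
  "(\<Prod>k=1..n. (4 * real k ^ 2) / (4 * real k ^ 2 - 1)) = (fact n) ^ 4 * 16 ^ n / ((fact (2 * n)) ^ 2 * (2 * real n + 1))"
proof (induction n)
  case (Suc n)
  have f2: "fact (2 * Suc n) = (2 * real n + 2) * (2 * real n + 1) * fact (2 * n)" by (simp add: algebra_simps)
  have "(\<Prod>k=1..Suc n. g k) = (\<Prod>k=1..n. g k) * g (Suc n)" for g :: "nat \<Rightarrow> real" by simp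
  hence "(\<Prod>k=1..Suc n. (4 * real k ^ 2) / (4 * real k ^ 2 - 1)) =
    (fact n) ^ 4 * 16 ^ n / ((fact (2 * n)) ^ 2 * (2 * real n + 1)) * ((4 * real (Suc n) ^ 2) / (4 * real (Suc n) ^ 2 - 1))"
    by (simp only: Suc)
  also have "4 * real (Suc n) ^ 2 - 1 = (2 * real n + 1) * (2 * real n + 3)" by (simp add: power2_eq_square algebra_simps)
  also have "(fact n) ^ 4 * 16 ^ n / ((fact (2 * n)) ^ 2 * (2 * real n + 1)) * ((4 * real (Suc n) ^ 2) / ((2 * real n + 1) * (2 * real n + 3))) =
    (fact (Suc n)) ^ 4 * 16 ^ Suc n / ((fact (2 * Suc n)) ^ 2 * (2 * real (Suc n) + 1))"
  proof -
    define a :: real where "a = fact n"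
    define b :: real where "b = fact (2 * n)"
    define c where "c = real n"
    have pos: "b > 0" "c \<ge> 0" by (auto simp: b_def c_def)
    have "a ^ 4 * 16 ^ n / (b ^ 2 * (2 * c + 1)) * ((4 * (c + 1) ^ 2) / ((2 * c + 1) * (2 * c + 3))) =
      ((c + 1) * a) ^ 4 * (16 * 16 ^ n) / (((2 * c + 2) * (2 * c + 1) * b) ^ 2 * (2 * c + 3))"
    proof -
      have nz: "c + 1 \<noteq> 0" "2 * c + 1 \<noteq> 0" "2 * c + 3 \<noteq> 0" "b \<noteq> 0" using pos by auto
      have "(2 * c + 2) = 2 * (c + 1)" by simp
      thus ?thesis using nz by (simp only: power_mult_distrib) (simp add: divide_simps, simp add: power2_eq_square power4_eq_xxxx)
    qed
    thus ?thesis unfolding f2 by (simp add: a_def b_def c_def algebra_simps)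
  qed
  finally show ?case .
qed simp

text \<open>
  Wallis' product identifies the limit \<open>c\<close>: the partial products are expressed by \<open>fact n\<close> and
  \<open>fact (2 * n)\<close>, and inserting the convergent errors gives the limit \<open>exp (2 * c) * pi / 2\<close>.
\<close>

theorem stirling_error_tendsto_0: "stirling_error \<longlonglongrightarrow> 0"
proof -
  obtain c where c: "stirling_error \<longlonglongrightarrow> c" using stirling_error_convergent by (auto simp: convergent_def)
  have "(\<lambda>n. exp (4 * stirling_error n - 2 * stirling_error (2 * n)) * (pi * real n / (2 * real n + 1))) \<longlonglongrightarrow> exp (4 * c - 2 * c) * (pi / 2)"
  proof -
    have "(\<lambda>n. stirling_error (2 * n)) \<longlonglongrightarrow> c"
      using LIMSEQ_subseq_LIMSEQ[OF c, of "\<lambda>n. 2 * n"] by (auto simp: strict_mono_def o_def)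
    moreover have "(\<lambda>n. pi * real n / (2 * real n + 1)) \<longlonglongrightarrow> pi / 2" by real_asymp
    ultimately show ?thesis using c by (intro tendsto_mult tendsto_exp tendsto_diff tendsto_const)
  qed
  moreover have "eventually (\<lambda>n. exp (4 * stirling_error n - 2 * stirling_error (2 * n)) * (pi * real n / (2 * real n + 1)) =
    (\<Prod>k=1..n. (4 * real k ^ 2) / (4 * real k ^ 2 - 1))) sequentially"
  proof (rule eventually_sequentiallyI[of 1])
    fix n :: nat assume n: "1 \<le> n"
    have s2: "sqrt (2 * pi * n) ^ 2 = 2 * pi * n" "sqrt (2 * pi * (2 * n)) ^ 2 = 2 * pi * (2 * n)" by simp_all
    have "(fact n :: real) ^ 4 = (exp (stirling_error n) ^ 4 * ((sqrt (2 * pi * n) ^ 2) ^ 2 * (real n ^ n) ^ 4 * exp (- real n) ^ 4))"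
      by (simp only: fact_stirling_error[OF n] power_mult_distrib flip: power_mult) simp
    also have "\<dots> = exp (4 * stirling_error n) * ((2 * pi * n) ^ 2 * (real n ^ n) ^ 4 * exp (- 4 * real n))"
      by (simp only: s2 flip: exp_of_nat_mult) simp
    finally have A: "(fact n :: real) ^ 4 = \<dots>" .
    have "(fact (2 * n) :: real) ^ 2 = exp (stirling_error (2 * n)) ^ 2 * (sqrt (2 * pi * (2 * n)) ^ 2 * (real (2 * n) ^ (2 * n)) ^ 2 * exp (- real (2 * n)) ^ 2)"
    proof -
      have "1 \<le> 2 * n" using n by simp
      thus ?thesis by (simp only: fact_stirling_error power_mult_distrib)
    qed
    also have "\<dots> = exp (2 * stirling_error (2 * n)) * (2 * pi * (2 * n) * (16 ^ n * (real n ^ n) ^ 4) * exp (- 4 * real n))"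
    proof -
      have "(real (2 * n) ^ (2 * n)) ^ 2 = (2 :: real) ^ (4 * n) * (real n ^ n) ^ 4"
        by (simp add: power_mult_distrib flip: power_mult) (simp add: mult.commute)
      also have "(2 :: real) ^ (4 * n) = 16 ^ n" by (simp add: power_mult)
      finally have "(real (2 * n) ^ (2 * n)) ^ 2 = 16 ^ n * (real n ^ n) ^ 4" .
      thus ?thesis by (simp only: s2 flip: exp_of_nat_mult) simp
    qed
    finally have B: "(fact (2 * n) :: real) ^ 2 = \<dots>" .
    have "real n > 0" using n by simp
    thus "exp (4 * stirling_error n - 2 * stirling_error (2 * n)) * (pi * real n / (2 * real n + 1)) =
      (\<Prod>k=1..n. (4 * real k ^ 2) / (4 * real k ^ 2 - 1))"
      unfolding wallis_prod A B by (simp add: exp_diff divide_simps) (simp add: power2_eq_square)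
  qed
  ultimately have "(\<lambda>n. \<Prod>k=1..n. (4 * real k ^ 2) / (4 * real k ^ 2 - 1)) \<longlonglongrightarrow> exp (4 * c - 2 * c) * (pi / 2)"
    using Lim_transform_eventually by fast
  hence "exp (4 * c - 2 * c) * (pi / 2) = pi / 2" using wallis LIMSEQ_unique by blast
  hence "c = 0" by simp
  thus ?thesis using c by simp
qed

section \<open>The local limit\<close>

definition greedy_size_prob :: "nat \<Rightarrow> nat \<Rightarrow> real" where
  "greedy_size_prob n k = real (n - 1 choose (k - 1)) * real (n - k) ^ (k - 1) * real k ^ (n - k - 1) / real n ^ (n - 2)"

definition gauss_density :: "real \<Rightarrow> real" where
  "gauss_density x = 1 / sqrt (2 * pi * (1 / 4)\<^sup>2) * exp (- (x\<^sup>2 / (2 * (1 / 4)\<^sup>2)))"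

lemma greedy_size_prob_pos:
  assumes "1 \<le> k" "k < n"
  shows "greedy_size_prob n k > 0"
  using assms by (simp add: greedy_size_prob_def zero_less_binomial)

lemma ln_greedy_size_prob:
  assumes k: "1 \<le> k" "k < n"
  defines "N \<equiv> real n" and "a \<equiv> real k" and "b \<equiv> real (n - k)"
  shows "ln (greedy_size_prob n k) = stirling_error n - stirling_error k - stirling_error (n - k)
     + (3 / 2 * ln N + (b - a - 1 / 2) * ln a + (a - b - 3 / 2) * ln b) - ln (2 * pi) / 2"
proof -
  have pos: "N > 0" "a > 0" "b > 0" using k by (auto simp: N_def a_def b_def)
  have ab: "N = a + b" using k by (simp add: N_def a_def b_def)
  have "real (n choose k) * a = N * real (n - 1 choose (k - 1))"
    using binomial_absorption[of "k - 1" n] k unfolding a_def N_def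
    by (metis Suc_diff_1 Suc_le_eq mult.commute of_nat_mult One_nat_def)
  hence "real (n - 1 choose (k - 1)) = fact n / (fact k * fact (n - k)) * a / N"
    using pos k by (simp add: binomial_fact field_simps)
  hence "ln (real (n - 1 choose (k - 1))) = ln (fact n) - ln (fact k) - ln (fact (n - k)) + ln a - ln N"
    using pos by (simp add: ln_mult ln_div)
  moreover have "real (k - 1) = a - 1" "real (n - k - 1) = b - 1" "real (n - 2) = N - 2"
    using k by (auto simp: a_def b_def N_def)
  moreover have "ln (greedy_size_prob n k) = ln (real (n - 1 choose (k - 1))) + real (k - 1) * ln b + real (n - k - 1) * ln a - real (n - 2) * ln N"
  proof -
    have "ln (C * b ^ p * a ^ q / N ^ r) = ln C + p * ln b + q * ln a - r * ln N"
      if "C > 0" for C and p q r :: nat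
      using pos that by (simp add: ln_mult ln_div ln_realpow)
    moreover have "real (n - 1 choose (k - 1)) > 0" using k by (simp add: zero_less_binomial)
    ultimately show ?thesis unfolding greedy_size_prob_def a_def b_def N_def by blast
  qed
  ultimately have "ln (greedy_size_prob n k) = ln (fact n) - ln (fact k) - ln (fact (n - k)) + ln a - ln N
     + (a - 1) * ln b + (b - 1) * ln a - (N - 2) * ln N" by simp
  thus ?thesis
    unfolding stirling_error_def N_def[symmetric] a_def[symmetric] b_def[symmetric] ab
    by (simp add: algebra_simps)
qed

text \<open>
  Writing \<open>k = n (1 + t) / 2\<close> and \<open>n - k = n (1 - t) / 2\<close>, all powers of \<open>n\<close> and of 2 cancel against the
  Gaussian prefactor.
\<close>

lemma ln_greedy_size_ratio:
  assumes k: "1 \<le> k" "k < n"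
  defines "t \<equiv> (2 * real k - real n) / real n"
  shows "greedy_size_prob n k / (1 / sqrt (real n) * gauss_density x) =
    exp (stirling_error n - stirling_error k - stirling_error (n - k) 
      + (real n * t * (ln (1 - t) - ln (1 + t)) + 8 * x\<^sup>2) - ln (1 + t) / 2 - 3 / 2 * ln (1 - t))"
proof -
  define N where "N = real n"
  define a where "a = real k"
  define b where "b = real (n - k)"
  have pos: "N > 0" "a > 0" "b > 0" using k by (auto simp: N_def a_def b_def)
  have ab: "N = a + b" using k by (simp add: N_def a_def b_def)
  have t: "t = (2 * a - N) / N" by (simp add: t_def N_def a_def)
  have t': "1 + t = 2 * a / N" "1 - t = 2 * b / N" using pos by (auto simp: t field_simps ab)
  have la: "ln a = ln N + ln (1 + t) - ln 2" and lb: "ln b = ln N + ln (1 - t) - ln 2"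
    unfolding t' using pos by (simp_all add: ln_mult ln_div)
  have diff: "a - b = N * t" using pos by (simp add: t ab)
  have target: "ln (1 / sqrt N * gauss_density x) = - ln N / 2 - ln (2 * pi) / 2 + 2 * ln 2 - 8 * x\<^sup>2"
  proof -
    have "x\<^sup>2 / (2 * (1 / 4)\<^sup>2) = 8 * x\<^sup>2" "sqrt (2 * pi * (1 / 4)\<^sup>2) = sqrt (2 * pi) * \<bar>1 / 4\<bar>"
      by (simp add: power2_eq_square, simp only: real_sqrt_mult real_sqrt_abs)
    hence "gauss_density x = 4 * (1 / sqrt (2 * pi)) * exp (- (8 * x\<^sup>2))"
      unfolding gauss_density_def by (simp only:) simp
    moreover have "ln (4::real) = 2 * ln 2" using ln_realpow[of 2 2] by simp
    ultimately show ?thesis using pos by (simp add: ln_mult ln_div ln_sqrt)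
  qed
  have tpos: "1 / sqrt N * gauss_density x > 0" using pos by (simp add: gauss_density_def)
  have "ln (greedy_size_prob n k) - ln (1 / sqrt N * gauss_density x) =
    stirling_error n - stirling_error k - stirling_error (n - k)
     + (3 / 2 * ln N + (b - a - 1 / 2) * ln a + (a - b - 3 / 2) * ln b)  + ln N / 2 - 2 * ln 2 + 8 * x\<^sup>2"
    unfolding target using ln_greedy_size_prob[OF k] by (simp add: N_def a_def b_def)
  also have "b - a = - (N * t)" using diff by simp
  also have "3 / 2 * ln N + (- (N * t) - 1 / 2) * ln a + (a - b - 3 / 2) * ln b =
    N * t * (ln (1 - t) - ln (1 + t)) - ln (1 + t) / 2 - 3 / 2 * ln (1 - t) - ln N / 2 + 2 * ln 2"
    unfolding diff la lb by (simp add: algebra_simps)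
  finally have "ln (greedy_size_prob n k) - ln (1 / sqrt N * gauss_density x) =
    stirling_error n - stirling_error k - stirling_error (n - k) 
      + (N * t * (ln (1 - t) - ln (1 + t)) + 8 * x\<^sup>2) - ln (1 + t) / 2 - 3 / 2 * ln (1 - t)"
    by simp
  hence "exp \<dots> = exp (ln (greedy_size_prob n k)) / exp (ln (1 / sqrt N * gauss_density x))"
    by (simp only: exp_diff[symmetric])
  thus ?thesis using tpos greedy_size_prob_pos[OF k] by (simp add: N_def)
qed

text \<open>
  With \<open>w = sqrt n * t\<close>, which differs from \<open>2 x\<close> by \<open>O(1 / sqrt n)\<close>, the term
  \<open>n t (ln (1 - t) - ln (1 + t))\<close> equals \<open>- 2 w\<^sup>2\<close> up to \<open>O(w\<^sup>2 \<bar>t\<bar>)\<close>, and so cancels \<open>8 x\<^sup>2\<close> in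
  the limit.
\<close>

theorem greedy_size_prob_local_limit:
  fixes x :: "nat \<Rightarrow> real" and k :: "nat \<Rightarrow> nat"
  assumes x: "\<And>n. \<bar>x n\<bar> \<le> A" and k: "\<forall>\<^sub>F n in sequentially. \<bar>real (k n) - (real n / 2 + x n * sqrt n)\<bar> \<le> 1"
  shows "\<forall>\<^sub>F n in sequentially. 1 \<le> k n \<and> k n < n"
    and "(\<lambda>n. greedy_size_prob n (k n) / (1 / sqrt (real n) * gauss_density (x n))) \<longlonglongrightarrow> 1"
proof -
  define w where "w n = (2 * real (k n) - real n) / sqrt n" for n
  define t where "t n = (2 * real (k n) - real n) / real n" for n
  have A: "A \<ge> 0" using x[of 0] by simp
  have tw: "t n = w n / sqrt n" for n by (simp add: t_def w_def)
  have wx: "\<forall>\<^sub>F n in sequentially. \<bar>w n - 2 * x n\<bar> \<le> 2 / sqrt n"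
    using k eventually_gt_at_top[of 0]
  proof eventually_elim
    case (elim n)
    have "w n - 2 * x n = 2 * (real (k n) - (real n / 2 + x n * sqrt n)) / sqrt n"
      using elim by (simp add: w_def field_simps)
    thus ?case using elim by (simp add: abs_mult divide_right_mono)
  qed
  have wx0: "(\<lambda>n. w n - 2 * x n) \<longlonglongrightarrow> 0"
  proof (rule Lim_null_comparison)
    show "\<forall>\<^sub>F n in sequentially. norm (w n - 2 * x n) \<le> 2 / sqrt n" using wx by simp
    show "(\<lambda>n. 2 / sqrt (real n)) \<longlonglongrightarrow> 0" by real_asymp
  qed
  have wb: "\<forall>\<^sub>F n in sequentially. \<bar>w n\<bar> \<le> 2 * A + 2"
    using wx eventually_gt_at_top[of 0]
  proof eventually_elim
    case (elim n)
    have "sqrt n \<ge> 1" using elim by simp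
    hence "2 / sqrt n \<le> 2" by (simp add: field_simps)
    thus ?case using elim x[of n] by linarith
  qed
  have t0: "t \<longlonglongrightarrow> 0"
  proof (rule Lim_null_comparison)
    show "\<forall>\<^sub>F n in sequentially. norm (t n) \<le> (2 * A + 2) / sqrt n"
      using wb by eventually_elim (simp add: tw divide_right_mono)
    show "(\<lambda>n. (2 * A + 2) / sqrt (real n)) \<longlonglongrightarrow> 0" by real_asymp
  qed
  have tb: "\<forall>\<^sub>F n in sequentially. \<bar>t n\<bar> < 1 / 2"
    using order_tendstoD(2)[OF tendsto_rabs[OF t0], of "1 / 2"] by simp
  have kb: "\<forall>\<^sub>F n in sequentially. real n / 4 < real (k n) \<and> real (k n) < 3 / 4 * real n"
    using tb eventually_gt_at_top[of 0]
  proof eventually_elim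
    case (elim n)
    hence "\<bar>2 * real (k n) - real n\<bar> < 1 / 2 * real n" by (simp add: t_def field_simps)
    thus ?case by linarith
  qed
  thus kn: "\<forall>\<^sub>F n in sequentially. 1 \<le> k n \<and> k n < n"
    using eventually_gt_at_top[of 0] by eventually_elim auto
  have lim4: "filterlim (\<lambda>n. n div 4) at_top (at_top :: nat filter)"
    by (rule filterlim_at_top_div_const_nat) simp
  have "filterlim k at_top sequentially"
    by (rule filterlim_at_top_mono[OF lim4]) (use kb in eventually_elim, linarith)
  hence ek: "(\<lambda>n. stirling_error (k n)) \<longlonglongrightarrow> 0"
    by (rule filterlim_compose[OF stirling_error_tendsto_0])
  have "filterlim (\<lambda>n. n - k n) at_top sequentially"
    by (rule filterlim_at_top_mono[OF lim4]) (use kb in eventually_elim, linarith)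
  hence enk: "(\<lambda>n. stirling_error (n - k n)) \<longlonglongrightarrow> 0"
    by (rule filterlim_compose[OF stirling_error_tendsto_0])
  have quad: "(\<lambda>n. real n * t n * (ln (1 - t n) - ln (1 + t n)) + 8 * (x n)\<^sup>2) \<longlonglongrightarrow> 0"
  proof -
    define R where "R n = ln (1 - t n) - ln (1 + t n) + 2 * t n" for n
    have nt: "real n * t n * t n = (w n)\<^sup>2" if "n > 0" for n
      using that by (simp add: tw power2_eq_square)
    have "(\<lambda>n. real n * t n * R n) \<longlonglongrightarrow> 0"
    proof (rule Lim_null_comparison)
      show "\<forall>\<^sub>F n in sequentially. norm (real n * t n * R n) \<le> 4 * (2 * A + 2)\<^sup>2 * \<bar>t n\<bar>"
        using tb wb eventually_gt_at_top[of 0]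
      proof eventually_elim
        case (elim n)
        have "\<bar>ln (1 + t n) - t n\<bar> \<le> 2 * (t n)\<^sup>2" "\<bar>ln (1 + - t n) - - t n\<bar> \<le> 2 * (- t n)\<^sup>2"
          using elim by (intro abs_ln_one_plus_x_minus_x_bound; simp)+
        hence "\<bar>R n\<bar> \<le> 4 * (t n)\<^sup>2" unfolding R_def by (simp add: abs_le_iff)
        hence "\<bar>real n * t n * R n\<bar> \<le> \<bar>real n * t n\<bar> * (4 * (t n)\<^sup>2)"
          by (simp add: abs_mult mult_left_mono)
        also have "\<dots> = 4 * (real n * t n * t n) * \<bar>t n\<bar>"
          by (simp add: abs_mult power2_eq_square abs_mult_self_eq)
        also have "\<dots> = 4 * (w n)\<^sup>2 * \<bar>t n\<bar>" using nt elim by simp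
        also have "(w n)\<^sup>2 \<le> (2 * A + 2)\<^sup>2" using elim A by (intro abs_le_square_iff[THEN iffD1]) simp
        finally show ?case by (simp add: mult_right_mono)
      qed
      show "(\<lambda>n. 4 * (2 * A + 2)\<^sup>2 * \<bar>t n\<bar>) \<longlonglongrightarrow> 0"
        using tendsto_mult_right_zero[OF tendsto_rabs_zero[OF t0]] .
    qed
    moreover have "(\<lambda>n. - 2 * ((w n - 2 * x n) * (w n + 2 * x n))) \<longlonglongrightarrow> 0"
    proof (intro tendsto_mult_right_zero)
      have "\<forall>\<^sub>F n in sequentially. norm (w n + 2 * x n) \<le> 4 * A + 2"
        using wb
      proof eventually_elim
        case (elim n)
        thus ?case using x[of n] unfolding real_norm_def by linarith
      qed
      thus "(\<lambda>n. (w n - 2 * x n) * (w n + 2 * x n)) \<longlonglongrightarrow> 0"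
        by (rule lim_null_mult_right_bounded[OF wx0])
    qed
    ultimately have "(\<lambda>n. real n * t n * R n + - 2 * ((w n - 2 * x n) * (w n + 2 * x n))) \<longlonglongrightarrow> 0"
      using tendsto_add_zero by blast
    moreover have "\<forall>\<^sub>F n in sequentially. real n * t n * R n + - 2 * ((w n - 2 * x n) * (w n + 2 * x n)) =
      real n * t n * (ln (1 - t n) - ln (1 + t n)) + 8 * (x n)\<^sup>2"
      using eventually_gt_at_top[of 0]
    proof eventually_elim
      case (elim n)
      have "real n * t n * R n = real n * t n * (ln (1 - t n) - ln (1 + t n)) + 2 * (real n * t n * t n)"
        by (simp add: R_def algebra_simps)
      thus ?case using nt[of n] elim by (simp add: power2_eq_square algebra_simps)
    qed
    ultimately show ?thesis by (rule Lim_transform_eventually)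
  qed
  have "(\<lambda>n. exp (stirling_error n - stirling_error (k n) - stirling_error (n - k n) 
      + (real n * t n * (ln (1 - t n) - ln (1 + t n)) + 8 * (x n)\<^sup>2) - ln (1 + t n) / 2 - 3 / 2 * ln (1 - t n)))
    \<longlonglongrightarrow> exp (0 - 0 - 0 + 0 - ln (1 + 0) / 2 - 3 / 2 * ln (1 - 0))"
    by (rule tendsto_exp, intro tendsto_diff tendsto_add[OF _ quad] stirling_error_tendsto_0 ek enk)
      (use t0 in \<open>auto intro!: tendsto_eq_intros\<close>)
  moreover have "\<forall>\<^sub>F n in sequentially. exp (stirling_error n - stirling_error (k n) - stirling_error (n - k n) 
      + (real n * t n * (ln (1 - t n) - ln (1 + t n)) + 8 * (x n)\<^sup>2) - ln (1 + t n) / 2 - 3 / 2 * ln (1 - t n)) =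
     greedy_size_prob n (k n) / (1 / sqrt (real n) * gauss_density (x n))"
    using kn by eventually_elim (simp only: ln_greedy_size_ratio t_def)
  ultimately show "(\<lambda>n. greedy_size_prob n (k n) / (1 / sqrt (real n) * gauss_density (x n))) \<longlonglongrightarrow> 1"
    using Lim_transform_eventually by force
qed

text \<open>
  If the convergence were not uniform, a sequence of points witnessing the failure would
  contradict the hypothesis.
\<close>

lemma uniform_limit_constI_sequences:
  fixes f :: "nat \<Rightarrow> 'a \<Rightarrow> 'b :: metric_space"
  assumes "S \<noteq> {}" and lim: "\<And>x. (\<And>n. x n \<in> S) \<Longrightarrow> (\<lambda>n. f n (x n)) \<longlonglongrightarrow> l"
  shows "uniform_limit S f (\<lambda>_. l) sequentially"
proof (rule uniform_limitI)
  fix e :: real assume e: "e > 0"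
  have "\<exists>y\<in>S. (\<exists>z\<in>S. \<not> dist (f n z) l < e) \<longrightarrow> \<not> dist (f n y) l < e" for n
    using assms(1) by blast
  then obtain x where x: "\<And>n. x n \<in> S" "\<And>n. (\<exists>z\<in>S. \<not> dist (f n z) l < e) \<Longrightarrow> \<not> dist (f n (x n)) l < e"
    by metis
  have "\<forall>\<^sub>F n in sequentially. dist (f n (x n)) l < e"
    using lim[OF x(1)] e by (rule tendstoD)
  thus "\<forall>\<^sub>F n in sequentially. \<forall>y\<in>S. dist (f n y) l < e"
    by eventually_elim (use x(2) in blast)
qed

section \<open>The size of the greedy independent set on a Cayley tree\<close>

theorem pmf_greedy_size_cayley:
  assumes n: "n \<ge> 2" and k: "k \<ge> 1"
  shows "pmf (greedy_size_cayley n) k = greedy_size_prob n k"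
proof -
  define V where "V = {1..n}"
  have V: "finite V" "V \<noteq> {}" "card V = n" using n by (auto simp: V_def)
  have T: "edges ` parent_maps (V - {v}) {v} = parcs ` cayley_trees n" if "v \<in> V" for v
    using that unfolding V_def by (rule parcs_cayley_trees)
  have "card (cayley_trees n) = card (parcs ` cayley_trees n)"
    by (simp add: card_image inj_on_parcs_cayley_trees)
  also have "parcs ` cayley_trees n = edges ` parent_maps (V - {1}) {1}"
    using T[of 1] n by (simp add: V_def)
  also have "card \<dots> = card (parent_maps (V - {1}) {1})"
    by (rule card_image) (auto intro!: inj_onI dest: edges_determine_parent_map)
  finally have "real (card (cayley_trees n)) = forest_number (n - 1) 1"
    using card_parent_maps[of "V - {1}" "{1}"] V n by (auto simp: V_def)
  hence card: "real (card (cayley_trees n)) = real n ^ (n - 2)"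
    using n by (simp add: forest_number_def numeral_2_eq_2)
  have "pmf (greedy_size_cayley n) k =
    (\<Sum>T\<in>cayley_trees n. pmf (map_pmf card (greedy_run T (pverts T, {}, {}))) k) / card (cayley_trees n)"
    unfolding greedy_size_cayley_def greedy_independent_set_def
    using cayley_trees_nonempty[of n] finite_cayley_trees[of n] n by (subst pmf_bind_pmf_of_set) auto
  also have "(\<Sum>T\<in>cayley_trees n. pmf (map_pmf card (greedy_run T (pverts T, {}, {}))) k) =
    (\<Sum>T\<in>cayley_trees n. greedy_prob k (parcs T) V)"
    by (intro sum.cong refl, subst pmf_card_greedy_run) (auto simp: cayley_trees_def V_def)
  also have "\<dots> = (\<Sum>E\<in>parcs ` cayley_trees n. greedy_prob k E V)"
    by (simp add: sum.reindex inj_on_parcs_cayley_trees)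
  also have "\<dots> = (n - 1 choose (k - 1)) * (real (n - k) ^ (k - 1) * real k ^ (n - k - 1))"
    using sum_greedy_prob_tree[OF V(1,2) T, of "k - 1"] k V(3) by (simp add: diff_diff_eq)
  finally show ?thesis by (simp add: greedy_size_prob_def card mult.assoc)
qed

theorem mainTheorem4:
  fixes A :: real
  assumes "A \<ge> 0"
  shows "uniform_limit {-A..A}
           (\<lambda>n x. measure_pmf.prob (greedy_size_cayley n)
                     {k. int k = \<lfloor>real n / 2 + x * sqrt (real n)\<rfloor>}
                  / (1 / sqrt (real n) * (1 / sqrt (2 * pi * (1 / 4)\<^sup>2))
                       * exp (- (x\<^sup>2 / (2 * (1 / 4)\<^sup>2)))))
           (\<lambda>x. 1) sequentially"
proof (rule uniform_limit_constI_sequences)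
  show "{-A..A} \<noteq> {}" using assms by auto
next
  fix x :: "nat \<Rightarrow> real"
  assume "\<And>n. x n \<in> {-A..A}"
  hence x: "\<bar>x n\<bar> \<le> A" for n by (simp add: abs_le_iff minus_le_iff)
  define m where "m n = \<lfloor>real n / 2 + x n * sqrt n\<rfloor>" for n
  define k where "k n = nat (m n)" for n
  have "\<forall>\<^sub>F n in sequentially. A * sqrt n \<le> real n / 2"
    by real_asymp
  hence m0: "\<forall>\<^sub>F n in sequentially. m n \<ge> 0"
  proof eventually_elim
    case (elim n)
    have "- (A * sqrt n) \<le> x n * sqrt n"
      using x[of n] mult_right_mono[of "- A" "x n" "sqrt n"] by (simp add: abs_le_iff)
    thus ?case using elim by (simp add: m_def)
  qed
  hence near: "\<forall>\<^sub>F n in sequentially. \<bar>real (k n) - (real n / 2 + x n * sqrt n)\<bar> \<le> 1"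
    by eventually_elim (simp add: k_def m_def, linarith)
  note limit = greedy_size_prob_local_limit[OF x near]
  have "\<forall>\<^sub>F n in sequentially. greedy_size_prob n (k n) / (1 / sqrt (real n) * gauss_density (x n)) =
     measure_pmf.prob (greedy_size_cayley n) {j. int j = \<lfloor>real n / 2 + x n * sqrt (real n)\<rfloor>}
       / (1 / sqrt (real n) * (1 / sqrt (2 * pi * (1 / 4)\<^sup>2)) * exp (- ((x n)\<^sup>2 / (2 * (1 / 4)\<^sup>2))))"
    using limit(1) m0
  proof eventually_elim
    case (elim n)
    have "{j. int j = \<lfloor>real n / 2 + x n * sqrt (real n)\<rfloor>} = {k n}"
      using elim(2) by (auto simp: k_def simp flip: m_def)
    moreover have "pmf (greedy_size_cayley n) (k n) = greedy_size_prob n (k n)"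
      using elim(1) by (intro pmf_greedy_size_cayley) auto
    ultimately show ?case by (simp add: measure_pmf_single gauss_density_def mult.assoc)
  qed
  with limit(2) show "(\<lambda>n. measure_pmf.prob (greedy_size_cayley n) {j. int j = \<lfloor>real n / 2 + x n * sqrt (real n)\<rfloor>}
       / (1 / sqrt (real n) * (1 / sqrt (2 * pi * (1 / 4)\<^sup>2)) * exp (- ((x n)\<^sup>2 / (2 * (1 / 4)\<^sup>2))))) \<longlonglongrightarrow> 1"
    by (rule Lim_transform_eventually)
qed

end
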